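(* Let $(M,F)$ be a connected complex Finsler space of complex dimension $2$ such that $$R_{\bar rj\bar hk}=\mathcal K\,(g_{j\bar r}g_{k\bar h}+g_{k\bar r}g_{j\bar h})$$ for a real-valued function $\mathcal K=\mathcal K(z,\eta)$ on $T'M$ with $\mathcal K\neq0$. Then $\mathcal K$ is a constant on $M$ if and only if $(M,F)$ is Kähler.
   Context: $M$ is a complex manifold with $\dim_{\mathbb C}M=2$; $T'M$ is its holomorphic tangent bundle with local coordinates $(z^k,\eta^k)_{k=1,2}$; $\widetilde{T'M}$ is $T'M$ minus the zero section. A complex Finsler space $(M,F)$: $F:T'M\to[0,\infty)$ is continuous, $L:=F^2$ is smooth on $\widetilde{T'M}$, $F(z,\eta)=0$ iff $\eta=0$, $F(z,\lambda\eta)=|\lambda|F(z,\eta)$ for all $\lambda\in\mathbb C$, and the Hermitian matrix $g_{i\bar j}:=\partial^2L/\partial\eta^i\partial\bar\eta^j$ is positive definite on $\widetilde{T'M}$. "Connected" means $M$ is connected. Repeated indices are summed over $\{1,2\}$; all identities are on $\widetilde{T'M}$, and $\mathcal K\ne0$ means nonvanishing at every point there. $(g^{\bar m i})$ is the inverse matrix: $g^{\bar m i}g_{j\bar m}=\delta^i_j$. Chern–Finsler connection: $\dot\partial_k:=\partial/\partial\eta^k$, $N^k_j:=g^{\bar mk}\frac{\partial g_{l\bar m}}{\partial z^j}\eta^l$, $\delta_k:=\frac{\partial}{\partial z^k}-N^j_k\dot\partial_j$, $\delta_{\bar k}:=\overline{\delta_k}$, $L^i_{jk}:=g^{\bar li}\delta_kg_{j\bar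 l}$, $C^i_{jk}:=g^{\bar li}\dot\partial_kg_{j\bar l}$. Curvature: $R^i_{j\bar hk}:=-\delta_{\bar h}L^i_{jk}-\delta_{\bar h}(N^l_k)C^i_{jl}$, $R_{\bar rj\bar hk}:=g_{i\bar r}R^i_{j\bar hk}$. With $T^i_{jk}:=L^i_{jk}-L^i_{kj}$, the space is Kähler if $T^i_{jk}\eta^j=0$ (known to be equivalent to $T^i_{jk}=0$). *)

theory Defs
  imports "HOL-Analysis.Analysis"
begin

section \<open>Smooth functions\<close>

text \<open>Meant for open \<open>S\<close>.\<close>

primrec Ck_on :: "nat \<Rightarrow> 'a::real_normed_vector set \<Rightarrow> ('a \<Rightarrow> 'b::real_normed_vector) \<Rightarrow> bool" where
  "Ck_on 0 S f \<longleftrightarrow> continuous_on S f"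
| "Ck_on (Suc n) S f \<longleftrightarrow>
     (\<forall>x\<in>S. f differentiable (at x)) \<and> (\<forall>v. Ck_on n S (\<lambda>x. frechet_derivative f (at x) v))"

definition smooth_on :: "'a::real_normed_vector set \<Rightarrow> ('a \<Rightarrow> 'b::real_normed_vector) \<Rightarrow> bool" where
  "smooth_on S f \<longleftrightarrow> (\<forall>n. Ck_on n S f)"


section \<open>Complex manifolds of dimension two\<close>

definition holomorphic2_on :: "(complex^2 \<Rightarrow> complex^2) \<Rightarrow> (complex^2) set \<Rightarrow> bool" where
  "holomorphic2_on f S \<longleftrightarrow>
     (\<forall>z\<in>S. \<exists>D. (f has_derivative D) (at z) \<and> (\<forall>c v. D (c *s v) = c *s D v))"

text \<open>A chart is a pair \<open>(U, \<phi>)\<close>; the values of \<open>\<phi>\<close> outside \<open>U\<close> are irrelevant.\<close>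

type_synonym 'a chart = "'a set \<times> ('a \<Rightarrow> complex^2)"

definition is_chart :: "'a::topological_space chart \<Rightarrow> bool" where
  "is_chart c \<longleftrightarrow> open (fst c) \<and> open (snd c ` fst c) \<and>
     (\<exists>\<psi>. homeomorphism (fst c) (snd c ` fst c) (snd c) \<psi>)"

definition chart_inv :: "'a chart \<Rightarrow> complex^2 \<Rightarrow> 'a" where
  "chart_inv c = inv_into (fst c) (snd c)"

definition transition :: "'a chart \<Rightarrow> 'a chart \<Rightarrow> complex^2 \<Rightarrow> complex^2" where
  "transition c d = snd d \<circ> chart_inv c"

text \<open>The manifold is the whole type; Hausdorff and second countable are imposed by its sort.\<close>

definition complex_atlas2 ::
    "'a::{t2_space, second_countable_topology} chart set \<Rightarrow> bool" where
  "complex_atlas2 A \<longleftrightarrow>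
     (\<forall>c\<in>A. is_chart c) \<and> (\<Union>c\<in>A. fst c) = UNIV \<and>
     (\<forall>c\<in>A. \<forall>d\<in>A. holomorphic2_on (transition c d) (snd c ` (fst c \<inter> fst d)))"


section \<open>The holomorphic tangent bundle\<close>

text \<open>A tangent vector at \<open>p\<close> is the family \<open>v\<close> of its component vectors \<open>\<eta> = v c\<close> in the charts
  \<open>c\<close> around \<open>p\<close>, subject to the transformation law of components; \<open>v\<close> is set to \<open>0\<close> on everything
  that is not a chart of the atlas around \<open>p\<close>, so that equality of families is equality of vectors.
  Linear operations are pointwise.\<close>

type_synonym 'a tvec = "'a chart \<Rightarrow> complex^2"

definition tangent_bundle :: "'a chart set \<Rightarrow> ('a \<times> 'a tvec) set" where
  "tangent_bundle A = {(p, v).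
     (\<forall>c\<in>A. \<forall>d\<in>A. p \<in> fst c \<inter> fst d \<longrightarrow>
        v d = frechet_derivative (transition c d) (at (snd c p)) (v c)) \<and>
     (\<forall>c. \<not> (c \<in> A \<and> p \<in> fst c) \<longrightarrow> v c = 0)}"

definition slit_tangent_bundle :: "'a chart set \<Rightarrow> ('a \<times> 'a tvec) set" where
  "slit_tangent_bundle A = {(p, v) \<in> tangent_bundle A. v \<noteq> (\<lambda>_. 0)}"

text \<open>The tangent vector at \<open>p\<close> whose components in the chart \<open>c\<close> are \<open>\<eta>\<close>.\<close>

definition tvec_of :: "'a chart set \<Rightarrow> 'a chart \<Rightarrow> 'a \<Rightarrow> complex^2 \<Rightarrow> 'a tvec" where
  "tvec_of A c p \<eta> = (\<lambda>d. if d \<in> A \<and> p \<in> fst d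
      then frechet_derivative (transition c d) (at (snd c p)) \<eta> else 0)"

text \<open>A function on the tangent bundle in the local coordinates \<open>(z, \<eta>)\<close> induced by \<open>c\<close>, defined on
  \<open>bundle_coords c\<close>.\<close>

definition in_coords :: "'a chart set \<Rightarrow> 'a chart \<Rightarrow> ('a \<times> 'a tvec \<Rightarrow> 'b) \<Rightarrow>
    (complex^2) \<times> (complex^2) \<Rightarrow> 'b" where
  "in_coords A c f = (\<lambda>(z, \<eta>). f (chart_inv c z, tvec_of A c (chart_inv c z) \<eta>))"

definition bundle_coords :: "'a chart \<Rightarrow> ((complex^2) \<times> (complex^2)) set" where
  "bundle_coords c = (snd c ` fst c) \<times> UNIV"

definition slit_coords :: "'a chart \<Rightarrow> ((complex^2) \<times> (complex^2)) set" where
  "slit_coords c = (snd c ` fst c) \<times> (- {0})"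


section \<open>The Chern--Finsler connection in local coordinates\<close>

type_synonym cfun = "(complex^2) \<times> (complex^2) \<Rightarrow> complex"

text \<open>Wirtinger derivatives with respect to \<open>z\<^sup>k\<close>, \<open>\<eta>\<^sup>k\<close> and their conjugates.\<close>

definition d_z :: "2 \<Rightarrow> cfun \<Rightarrow> cfun" where
  "d_z k f x = (frechet_derivative f (at x) (axis k 1, 0)
      - \<i> * frechet_derivative f (at x) (axis k \<i>, 0)) / 2"

definition d_zbar :: "2 \<Rightarrow> cfun \<Rightarrow> cfun" where
  "d_zbar k f x = (frechet_derivative f (at x) (axis k 1, 0)
      + \<i> * frechet_derivative f (at x) (axis k \<i>, 0)) / 2"

definition d_eta :: "2 \<Rightarrow> cfun \<Rightarrow> cfun" where
  "d_eta k f x = (frechet_derivative f (at x) (0, axis k 1)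
      - \<i> * frechet_derivative f (at x) (0, axis k \<i>)) / 2"

definition d_etabar :: "2 \<Rightarrow> cfun \<Rightarrow> cfun" where
  "d_etabar k f x = (frechet_derivative f (at x) (0, axis k 1)
      + \<i> * frechet_derivative f (at x) (0, axis k \<i>)) / 2"

text \<open>In the following, upper indices come first, then lower indices, each in the order of the
  usual notation; barred indices are not marked.\<close>

definition g_lower :: "cfun \<Rightarrow> 2 \<Rightarrow> 2 \<Rightarrow> cfun" where
  "g_lower L i j = d_eta i (d_etabar j L)"

definition g_matrix :: "cfun \<Rightarrow> (complex^2) \<times> (complex^2) \<Rightarrow> complex^2^2" where
  "g_matrix L x = (\<chi> i j. g_lower L i j x)"

definition g_upper :: "cfun \<Rightarrow> 2 \<Rightarrow> 2 \<Rightarrow> cfun" where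
  "g_upper L m i x = matrix_inv (g_matrix L x) $ m $ i"

definition CF_N :: "cfun \<Rightarrow> 2 \<Rightarrow> 2 \<Rightarrow> cfun" where
  "CF_N L k j x = (\<Sum>m\<in>UNIV. \<Sum>l\<in>UNIV. g_upper L m k x * d_z j (g_lower L l m) x * snd x $ l)"

definition delta :: "cfun \<Rightarrow> 2 \<Rightarrow> cfun \<Rightarrow> cfun" where
  "delta L k f x = d_z k f x - (\<Sum>j\<in>UNIV. CF_N L j k x * d_eta j f x)"

definition delta_bar :: "cfun \<Rightarrow> 2 \<Rightarrow> cfun \<Rightarrow> cfun" where
  "delta_bar L k f x = d_zbar k f x - (\<Sum>j\<in>UNIV. cnj (CF_N L j k x) * d_etabar j f x)"

definition CF_L :: "cfun \<Rightarrow> 2 \<Rightarrow> 2 \<Rightarrow> 2 \<Rightarrow> cfun" where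
  "CF_L L i j k x = (\<Sum>l\<in>UNIV. g_upper L l i x * delta L k (g_lower L j l) x)"

definition CF_C :: "cfun \<Rightarrow> 2 \<Rightarrow> 2 \<Rightarrow> 2 \<Rightarrow> cfun" where
  "CF_C L i j k x = (\<Sum>l\<in>UNIV. g_upper L l i x * d_eta k (g_lower L j l) x)"

definition CF_curvature :: "cfun \<Rightarrow> 2 \<Rightarrow> 2 \<Rightarrow> 2 \<Rightarrow> 2 \<Rightarrow> cfun" where
  "CF_curvature L i j h k x = - delta_bar L h (CF_L L i j k) x
      - (\<Sum>l\<in>UNIV. delta_bar L h (CF_N L l k) x * CF_C L i j l x)"

definition CF_curvature_lowered :: "cfun \<Rightarrow> 2 \<Rightarrow> 2 \<Rightarrow> 2 \<Rightarrow> 2 \<Rightarrow> cfun" where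
  "CF_curvature_lowered L r j h k x = (\<Sum>i\<in>UNIV. g_lower L i r x * CF_curvature L i j h k x)"

definition CF_torsion :: "cfun \<Rightarrow> 2 \<Rightarrow> 2 \<Rightarrow> 2 \<Rightarrow> cfun" where
  "CF_torsion L i j k x = CF_L L i j k x - CF_L L i k j x"


section \<open>Complex Finsler spaces\<close>

definition hermitian_pos_def :: "complex^2^2 \<Rightarrow> bool" where
  "hermitian_pos_def G \<longleftrightarrow> (\<forall>i j. G $ j $ i = cnj (G $ i $ j)) \<and>
     (\<forall>w. w \<noteq> 0 \<longrightarrow> 0 < Re (\<Sum>i\<in>UNIV. \<Sum>j\<in>UNIV. G $ i $ j * w $ i * cnj (w $ j)))"

definition local_L :: "'a chart set \<Rightarrow> ('a \<times> 'a tvec \<Rightarrow> real) \<Rightarrow> 'a chart \<Rightarrow> cfun" where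
  "local_L A F c x = complex_of_real ((in_coords A c F x)\<^sup>2)"

text \<open>Continuity and smoothness on the tangent bundle refer to its standard manifold structure,
  given by the coordinates \<open>(z, \<eta>)\<close>.\<close>

definition complex_finsler :: "'a chart set \<Rightarrow> ('a \<times> 'a tvec \<Rightarrow> real) \<Rightarrow> bool" where
  "complex_finsler A F \<longleftrightarrow>
     (\<forall>x\<in>tangent_bundle A. F x \<ge> 0) \<and>
     (\<forall>c\<in>A. continuous_on (bundle_coords c) (in_coords A c F)) \<and>
     (\<forall>c\<in>A. smooth_on (slit_coords c) (\<lambda>x. (in_coords A c F x)\<^sup>2)) \<and>
     (\<forall>(p, v)\<in>tangent_bundle A. F (p, v) = 0 \<longleftrightarrow> v = (\<lambda>_. 0)) \<and>
     (\<forall>(p, v)\<in>tangent_bundle A. \<forall>\<mu>. F (p, \<lambda>c. \<mu> *s v c) = cmod \<mu> * F (p, v)) \<and>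
     (\<forall>c\<in>A. \<forall>x\<in>slit_coords c. hermitian_pos_def (g_matrix (local_L A F c) x))"

definition finsler_kaehler :: "'a chart set \<Rightarrow> ('a \<times> 'a tvec \<Rightarrow> real) \<Rightarrow> bool" where
  "finsler_kaehler A F \<longleftrightarrow>
     (\<forall>c\<in>A. \<forall>x\<in>slit_coords c. \<forall>i k.
        (\<Sum>j\<in>UNIV. CF_torsion (local_L A F c) i j k x * snd x $ j) = 0)"

end

theory Submission
  imports Defs
begin

text \<open>
  Write \<open>L = F\<^sup>2\<close> and let \<open>A\<close> be the derivative of the spray coefficients \<open>N\<^sup>i\<^sub>k \<eta>\<^sup>k\<close> with respect to the
  conjugates of the fibre coordinates. Contracting the curvature equation with \<open>\<eta>\<close> and its
  conjugate and differentiating along the fibre gives an equation that can be compared with the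
  curvature equation itself. A further contraction with \<open>\<eta>\<close> expresses the product of \<open>A\<close> and its
  conjugate as \<open>2 L \<eta>\<close> times the fibre derivative of \<open>K\<close>. Since \<open>g A\<close> is symmetric and annihilates
  the conjugate of \<open>\<eta>\<close>, pairing with the gradient of \<open>L\<close> shows that \<open>K\<close> is constant on fibres, and
  then the definiteness of \<open>g\<close> gives \<open>A = 0\<close>. What remains of the comparison, with \<open>K \<noteq> 0\<close>, forces
  the pure second derivatives of \<open>L\<close> along the fibre to vanish, so \<open>F\<close> comes from a Hermitian metric.

  For a Hermitian metric the trace of the curvature equation says that \<open>-3 K g\<close> is the mixed
  second derivative of the logarithm of \<open>det g\<close>; hence the (1,1)-form of \<open>K g\<close> is closed, which
  expresses \<open>K\<close> times the torsion through the differential of \<open>K\<close>.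
\<close>

section \<open>Calculus of smooth functions\<close>

lemma bounded_linear_imp_differentiable: "bounded_linear h \<Longrightarrow> h differentiable F"
  using bounded_linear_imp_has_derivative differentiable_def by blast

lemma frechet_derivative_bounded_linear_compose:
  assumes "f differentiable at x" "bounded_linear h"
  shows "frechet_derivative (\<lambda>x. h (f x)) (at x) v = h (frechet_derivative f (at x) v)"
proof -
  have "((\<lambda>x. h (f x)) has_derivative (\<lambda>v. h (frechet_derivative f (at x) v))) (at x)"
    using bounded_linear.has_derivative[OF assms(2)] assms(1) frechet_derivative_works by blast
  from frechet_derivative_at[OF this] show ?thesis by metis
qed

lemma frechet_derivative_bilinear:
  assumes "f differentiable at x" "g differentiable at x" "bounded_bilinear p"
  shows "frechet_derivative (\<lambda>x. p (f x) (g x)) (at x) v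
    = p (f x) (frechet_derivative g (at x) v) + p (frechet_derivative f (at x) v) (g x)"
proof -
  have "((\<lambda>x. p (f x) (g x)) has_derivative
      (\<lambda>v. p (f x) (frechet_derivative g (at x) v) + p (frechet_derivative f (at x) v) (g x))) (at x)"
    by (intro bounded_bilinear.FDERIV[OF assms(3)] frechet_derivative_works[THEN iffD1] assms)
  from frechet_derivative_at[OF this] show ?thesis by metis
qed

lemma frechet_derivative_add:
  assumes "f differentiable at x" "g differentiable at x"
  shows "frechet_derivative (\<lambda>x. f x + g x) (at x) v
    = frechet_derivative f (at x) v + frechet_derivative g (at x) v"
proof -
  have "((\<lambda>x. f x + g x) has_derivative
      (\<lambda>v. frechet_derivative f (at x) v + frechet_derivative g (at x) v)) (at x)"
    using assms by (intro has_derivative_add) (simp_all add: frechet_derivative_works[symmetric])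
  from frechet_derivative_at[OF this] show ?thesis by metis
qed

lemma frechet_derivative_inverse:
  fixes f :: "'a::real_normed_vector \<Rightarrow> complex"
  assumes "f differentiable at x" "f x \<noteq> 0"
  shows "frechet_derivative (\<lambda>x. inverse (f x)) (at x) v
    = - (inverse (f x) * frechet_derivative f (at x) v * inverse (f x))"
proof -
  have "((\<lambda>x. inverse (f x)) has_derivative
      (\<lambda>v. - (inverse (f x) * frechet_derivative f (at x) v * inverse (f x)))) (at x)"
    using assms by (intro Deriv.has_derivative_inverse) (simp_all add: frechet_derivative_works[symmetric])
  from frechet_derivative_at[OF this] show ?thesis by metis
qed

text \<open>On an open set the functions agree near \<open>x\<close>, so they have the same
  derivative candidates \<open>D\<close>; the choice hidden in \<open>frechet_derivative\<close>
  then agrees even where neither function is differentiable.\<close>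

lemma frechet_derivative_cong_open:
  assumes "open S" "x \<in> S" "\<And>y. y \<in> S \<Longrightarrow> f y = g y"
  shows "frechet_derivative f (at x) = frechet_derivative g (at x)"
proof -
  have "(f has_derivative D) (at x) \<longleftrightarrow> (g has_derivative D) (at x)" for D
    using assms has_derivative_transform_within_open[of f D x UNIV S g]
      has_derivative_transform_within_open[of g D x UNIV S f] by auto
  then show ?thesis by (simp add: frechet_derivative_def)
qed

lemma differentiable_cong_open:
  assumes "open S" "x \<in> S" "\<And>y. y \<in> S \<Longrightarrow> f y = g y" "f differentiable at x"
  shows "g differentiable at x"
  using has_derivative_transform_within_open[of f _ x UNIV S g] assms
  unfolding differentiable_def by blast

lemma Ck_on_cong:
  assumes "open S" "\<And>x. x \<in> S \<Longrightarrow> f x = g x" "Ck_on n S f"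
  shows "Ck_on n S g"
  using assms(2,3)
proof (induction n arbitrary: f g)
  case 0
  then show ?case by (simp cong: continuous_on_cong)
next
  case (Suc n)
  have "g differentiable at x" if "x \<in> S" for x
    using differentiable_cong_open[OF assms(1) that Suc.prems(1)] Suc.prems(2) that by auto
  moreover have "Ck_on n S (\<lambda>x. frechet_derivative g (at x) v)" for v
  proof (rule Suc.IH)
    show "Ck_on n S (\<lambda>x. frechet_derivative f (at x) v)"
      using Suc.prems(2) by simp
  qed (use frechet_derivative_cong_open[OF assms(1) _ Suc.prems(1)] in auto)
  ultimately show ?case by simp
qed

lemma Ck_on_SucD: "Ck_on (Suc n) S f \<Longrightarrow> Ck_on n S f"
proof (induction n arbitrary: f)
  case 0
  then show ?case
    by (auto intro!: differentiable_imp_continuous_on simp: differentiable_on_def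
        differentiable_at_withinI)
next
  case (Suc n)
  then show ?case by (metis Ck_on.simps(2))
qed

lemma Ck_on_const: "Ck_on n S (\<lambda>x. c)"
  by (induction n arbitrary: c) simp_all

lemma Ck_on_bounded_linear:
  assumes "bounded_linear h"
  shows "Ck_on n S h"
proof (cases n)
  case 0
  then show ?thesis using assms by (simp add: linear_continuous_on)
next
  case (Suc m)
  have "frechet_derivative h (at x) = h" for x
    using frechet_derivative_at[OF bounded_linear_imp_has_derivative[OF assms]] by metis
  then show ?thesis
    by (simp add: Suc Ck_on_const bounded_linear_imp_differentiable[OF assms])
qed

lemma Ck_on_bounded_linear_compose:
  assumes "open S" "bounded_linear h" "Ck_on n S f"
  shows "Ck_on n S (\<lambda>x. h (f x))"
  using assms(3)
proof (induction n arbitrary: f)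
  case 0
  then show ?case using assms(2) by (simp add: bounded_linear.continuous_on)
next
  case (Suc n)
  have d: "f differentiable at x" if "x \<in> S" for x
    using Suc.prems that by simp
  have "Ck_on n S (\<lambda>x. frechet_derivative (\<lambda>x. h (f x)) (at x) v)" for v
  proof (rule Ck_on_cong[OF assms(1)])
    show "Ck_on n S (\<lambda>x. h (frechet_derivative f (at x) v))"
      using Suc by simp
  qed (simp add: frechet_derivative_bounded_linear_compose d assms(2))
  moreover have "(\<lambda>x. h (f x)) differentiable at x" if "x \<in> S" for x
    using differentiable_compose[OF bounded_linear_imp_differentiable[OF assms(2)] d[OF that]] .
  ultimately show ?case by simp
qed

lemma Ck_on_add:
  assumes "open S" "Ck_on n S f" "Ck_on n S g"
  shows "Ck_on n S (\<lambda>x. f x + g x)"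
  using assms(2,3)
proof (induction n arbitrary: f g)
  case 0
  then show ?case by (simp add: continuous_on_add)
next
  case (Suc n)
  then have d: "f differentiable at x" "g differentiable at x" if "x \<in> S" for x
    using that by simp_all
  have "Ck_on n S (\<lambda>x. frechet_derivative (\<lambda>x. f x + g x) (at x) v)" for v
  proof (rule Ck_on_cong[OF assms(1)])
    show "Ck_on n S (\<lambda>x. frechet_derivative f (at x) v + frechet_derivative g (at x) v)"
      using Suc by simp
  qed (simp add: frechet_derivative_add d)
  then show ?case using d by simp
qed

text \<open>By the product rule the derivative is a sum of two products; \<open>Ck_on_SucD\<close>
  lowers the order of the undifferentiated factor to match the induction hypothesis.\<close>

lemma Ck_on_bilinear:
  assumes "open S" "bounded_bilinear p" "Ck_on n S f" "Ck_on n S g"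
  shows "Ck_on n S (\<lambda>x. p (f x) (g x))"
  using assms(3,4)
proof (induction n arbitrary: f g)
  case 0
  then show ?case using assms(2) by (simp add: bounded_bilinear.continuous_on)
next
  case (Suc n)
  then have d: "f differentiable at x" "g differentiable at x" if "x \<in> S" for x
    using that by simp_all
  have "Ck_on n S (\<lambda>x. frechet_derivative (\<lambda>x. p (f x) (g x)) (at x) v)" for v
  proof (rule Ck_on_cong[OF assms(1)])
    show "Ck_on n S (\<lambda>x. p (f x) (frechet_derivative g (at x) v)
        + p (frechet_derivative f (at x) v) (g x))"
      using Suc by (intro Ck_on_add[OF assms(1)] Suc.IH) (simp_all add: Ck_on_SucD del: Ck_on.simps,
        simp_all)
  qed (simp add: frechet_derivative_bilinear d assms(2))
  moreover have "(\<lambda>x. p (f x) (g x)) differentiable at x" if "x \<in> S" for x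
    using bounded_bilinear.FDERIV[OF assms(2)] d[OF that] unfolding differentiable_def by blast
  ultimately show ?case by simp
qed

text \<open>The derivative of the inverse is a product involving the inverse itself, which the
  induction hypothesis covers one order lower.\<close>

lemma Ck_on_inverse:
  fixes f :: "'a::real_normed_vector \<Rightarrow> complex"
  assumes "open S" "Ck_on n S f" "\<And>x. x \<in> S \<Longrightarrow> f x \<noteq> 0"
  shows "Ck_on n S (\<lambda>x. inverse (f x))"
  using assms(2)
proof (induction n)
  case 0
  then show ?case using assms(3) by (simp add: continuous_on_inverse)
next
  case (Suc n)
  then have d: "f differentiable at x" if "x \<in> S" for x
    using that by simp
  have inv: "Ck_on n S (\<lambda>x. inverse (f x))"
    by (rule Suc.IH[OF Ck_on_SucD[OF Suc.prems]])
  have "Ck_on n S (\<lambda>x. frechet_derivative (\<lambda>x. inverse (f x)) (at x) v)" for v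
  proof (rule Ck_on_cong[OF assms(1)])
    show "Ck_on n S (\<lambda>x. - (inverse (f x) * frechet_derivative f (at x) v * inverse (f x)))"
      using Suc.prems
      by (intro Ck_on_bounded_linear_compose[OF assms(1) bounded_linear_minus[OF bounded_linear_ident]]
          Ck_on_bilinear[OF assms(1) bounded_bilinear_mult] inv) simp
  qed (simp add: frechet_derivative_inverse d assms(3))
  moreover have "(\<lambda>x. inverse (f x)) differentiable at x" if "x \<in> S" for x
    using d[OF that] assms(3)[OF that] by (simp add: differentiable_inverse)
  ultimately show ?case by simp
qed

lemma smooth_on_differentiable: "smooth_on S f \<Longrightarrow> x \<in> S \<Longrightarrow> f differentiable at x"
  unfolding smooth_on_def by (metis Ck_on.simps(2))

lemma smooth_on_frechet_derivative:
  "smooth_on S f \<Longrightarrow> smooth_on S (\<lambda>x. frechet_derivative f (at x) v)"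
  unfolding smooth_on_def by (metis Ck_on.simps(2))

section \<open>Symmetry of second derivatives\<close>

lemma DERIV_along_line:
  fixes f :: "'a::real_normed_vector \<Rightarrow> real"
  assumes "f differentiable at (y + t *\<^sub>R u)"
  shows "((\<lambda>s. f (y + s *\<^sub>R u)) has_real_derivative frechet_derivative f (at (y + t *\<^sub>R u)) u) (at t)"
proof -
  let ?D = "frechet_derivative f (at (y + t *\<^sub>R u))"
  have "(f has_derivative ?D) (at (y + t *\<^sub>R u))"
    using assms frechet_derivative_works by blast
  then have "((\<lambda>s. f (y + s *\<^sub>R u)) has_derivative (\<lambda>s. ?D (s *\<^sub>R u))) (at t)"
    by (intro has_derivative_compose[of "\<lambda>s. y + s *\<^sub>R u" "\<lambda>s. s *\<^sub>R u" t UNIV f])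
      (auto intro!: derivative_eq_intros)
  moreover have "?D (s *\<^sub>R u) = ?D u * s" for s
    using linear_frechet_derivative[OF assms] by (simp add: linear_scale)
  ultimately show ?thesis by (simp add: has_field_derivative_def)
qed

text \<open>The mean value theorem is applied twice: to the difference in direction \<open>v\<close>
  as a function of the step along \<open>u\<close>, and then to the resulting derivative along
  \<open>v\<close>.\<close>

lemma second_difference_mean_value:
  fixes f :: "'a::real_normed_vector \<Rightarrow> real"
  assumes "s > 0"
    and box: "\<And>a b. 0 \<le> a \<Longrightarrow> a \<le> s \<Longrightarrow> 0 \<le> b \<Longrightarrow> b \<le> s \<Longrightarrow> x + a *\<^sub>R u + b *\<^sub>R v \<in> S"
    and f: "\<And>y. y \<in> S \<Longrightarrow> f differentiable at y"
    and fu: "\<And>y. y \<in> S \<Longrightarrow> (\<lambda>y. frechet_derivative f (at y) u) differentiable at y"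
  obtains a b where "0 \<le> a" "a \<le> s" "0 \<le> b" "b \<le> s"
    "f (x + s *\<^sub>R u + s *\<^sub>R v) - f (x + s *\<^sub>R u) - f (x + s *\<^sub>R v) + f x
      = s * s * frechet_derivative (\<lambda>y. frechet_derivative f (at y) u) (at (x + a *\<^sub>R u + b *\<^sub>R v)) v"
proof -
  define D where "D y = frechet_derivative f (at y) u" for y
  have "((\<lambda>a. f (x + a *\<^sub>R u + s *\<^sub>R v) - f (x + a *\<^sub>R u)) has_real_derivative
        D (x + a *\<^sub>R u + s *\<^sub>R v) - D (x + a *\<^sub>R u)) (at a)" if "0 \<le> a" "a \<le> s" for a
  proof (rule DERIV_diff)
    show "((\<lambda>a. f (x + a *\<^sub>R u + s *\<^sub>R v)) has_real_derivative D (x + a *\<^sub>R u + s *\<^sub>R v)) (at a)"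
      using DERIV_along_line[of f "x + s *\<^sub>R v" a u] box[of a s] f that assms(1)
      by (simp add: D_def add_ac)
    show "((\<lambda>a. f (x + a *\<^sub>R u)) has_real_derivative D (x + a *\<^sub>R u)) (at a)"
      using DERIV_along_line[of f x a u] box[of a 0] f that assms(1)
      by (simp add: D_def)
  qed
  from MVT2[OF assms(1) this] obtain a where a: "0 < a" "a < s" and
    1: "f (x + s *\<^sub>R u + s *\<^sub>R v) - f (x + s *\<^sub>R u) - (f (x + 0 *\<^sub>R u + s *\<^sub>R v) - f (x + 0 *\<^sub>R u))
       = (s - 0) * (D (x + a *\<^sub>R u + s *\<^sub>R v) - D (x + a *\<^sub>R u))"
    by blast
  have "((\<lambda>b. D (x + a *\<^sub>R u + b *\<^sub>R v)) has_real_derivative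
        frechet_derivative D (at (x + a *\<^sub>R u + b *\<^sub>R v)) v) (at b)" if "0 \<le> b" "b \<le> s" for b
    using DERIV_along_line[of D "x + a *\<^sub>R u" b v] box[of a b] fu that a
    by (simp add: D_def[abs_def])
  from MVT2[OF assms(1) this] obtain b where b: "0 < b" "b < s" and
    2: "D (x + a *\<^sub>R u + s *\<^sub>R v) - D (x + a *\<^sub>R u + 0 *\<^sub>R v)
       = (s - 0) * frechet_derivative D (at (x + a *\<^sub>R u + b *\<^sub>R v)) v" by blast
  show ?thesis
    using that[of a b] a b 1 2 by (simp add: D_def[abs_def] algebra_simps)
qed

text \<open>Both orders of differentiation come from the same second difference. Distinct values at
  \<open>x\<close> would by continuity stay apart on a small box, contradicting the mean value
  formula.\<close>

lemma symmetric_second_derivative_real: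
  fixes f :: "'a::real_normed_vector \<Rightarrow> real"
  assumes S: "open S" and x: "x \<in> S" and f: "Ck_on 2 S f"
  shows "frechet_derivative (\<lambda>y. frechet_derivative f (at y) u) (at x) v
       = frechet_derivative (\<lambda>y. frechet_derivative f (at y) v) (at x) u"
proof (rule ccontr)
  define P where "P y = frechet_derivative (\<lambda>y. frechet_derivative f (at y) u) (at y) v" for y
  define Q where "Q y = frechet_derivative (\<lambda>y. frechet_derivative f (at y) v) (at y) u" for y
  assume "\<not> ?thesis"
  then have ne: "P x \<noteq> Q x" by (simp add: P_def Q_def)
  \<comment> \<open>Half the gap: numbers closer than \<open>e\<close> to \<open>P x\<close> and to
    \<open>Q x\<close> cannot coincide.\<close>
  define e where "e = \<bar>P x - Q x\<bar> / 2"
  have e: "e > 0" using ne by (simp add: e_def)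
  have c: "continuous_on S P" "continuous_on S Q"
    using f by (simp_all add: P_def[abs_def] Q_def[abs_def] numeral_2_eq_2)
  have d: "\<And>y. y \<in> S \<Longrightarrow> f differentiable at y"
      "\<And>y w. y \<in> S \<Longrightarrow> (\<lambda>y. frechet_derivative f (at y) w) differentiable at y"
    using f by (simp_all add: numeral_2_eq_2)
  obtain d1 where d1: "d1 > 0" "\<And>y. y \<in> S \<Longrightarrow> dist y x < d1 \<Longrightarrow> dist (P y) (P x) < e"
    using c(1) x e unfolding continuous_on_iff by metis
  obtain d2 where d2: "d2 > 0" "\<And>y. y \<in> S \<Longrightarrow> dist y x < d2 \<Longrightarrow> dist (Q y) (Q x) < e"
    using c(2) x e unfolding continuous_on_iff by metis
  obtain d3 where d3: "d3 > 0" "\<And>y. dist y x < d3 \<Longrightarrow> y \<in> S"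
    using S x unfolding open_dist by metis
  define r where "r = min d1 (min d2 d3)"
  have r: "r > 0" using d1 d2 d3 by (simp add: r_def)
  \<comment> \<open>The box with sides along \<open>s\<close> times \<open>u\<close> and
    \<open>v\<close> then lies within \<open>r\<close> of \<open>x\<close>; the added
    \<open>1\<close> keeps the denominator positive and the bound strict.\<close>
  define s where "s = r / (norm u + norm v + 1)"
  have pos: "norm u + norm v + 1 > 0" by (simp add: add_nonneg_pos)
  have s: "s > 0" using r pos by (simp add: s_def)
  have close: "dist (x + a *\<^sub>R w + b *\<^sub>R w') x < r"
    if "0 \<le> a" "a \<le> s" "0 \<le> b" "b \<le> s" "norm w + norm w' = norm u + norm v" for a b w w'
  proof -
    have "dist (x + a *\<^sub>R w + b *\<^sub>R w') x = norm (a *\<^sub>R w + b *\<^sub>R w')"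
      by (simp add: dist_norm add.assoc)
    also have "\<dots> \<le> a * norm w + b * norm w'"
      using norm_triangle_ineq[of "a *\<^sub>R w" "b *\<^sub>R w'"] that by simp
    also have "\<dots> \<le> s * norm w + s * norm w'"
      using that by (intro add_mono mult_right_mono) auto
    also have "\<dots> = s * (norm u + norm v)" using that(5) by (simp flip: distrib_left)
    also have "\<dots> < s * (norm u + norm v + 1)" using s by simp
    also have "\<dots> = r" using pos by (simp add: s_def)
    finally show ?thesis .
  qed
  have box: "x + a *\<^sub>R w + b *\<^sub>R w' \<in> S"
    if "0 \<le> a" "a \<le> s" "0 \<le> b" "b \<le> s" "norm w + norm w' = norm u + norm v" for a b w w'
    using close[OF that] d3(2) by (simp add: r_def)
  obtain a b where ab: "0 \<le> a" "a \<le> s" "0 \<le> b" "b \<le> s" and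
    1: "f (x + s *\<^sub>R u + s *\<^sub>R v) - f (x + s *\<^sub>R u) - f (x + s *\<^sub>R v) + f x
      = s * s * P (x + a *\<^sub>R u + b *\<^sub>R v)"
    unfolding P_def
    by (rule second_difference_mean_value[OF s, of x u v S f]) (use box d in auto)
  obtain a' b' where ab': "0 \<le> a'" "a' \<le> s" "0 \<le> b'" "b' \<le> s" and
    2: "f (x + s *\<^sub>R v + s *\<^sub>R u) - f (x + s *\<^sub>R v) - f (x + s *\<^sub>R u) + f x
      = s * s * Q (x + a' *\<^sub>R v + b' *\<^sub>R u)"
    unfolding Q_def
    by (rule second_difference_mean_value[OF s, of x v u S f]) (use box d in auto)
  have "x + s *\<^sub>R v + s *\<^sub>R u = x + s *\<^sub>R u + s *\<^sub>R v" by (simp add: add_ac)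
  note 2 = 2[unfolded this]
  have "s * s * P (x + a *\<^sub>R u + b *\<^sub>R v) = s * s * Q (x + a' *\<^sub>R v + b' *\<^sub>R u)"
    unfolding 1[symmetric] 2[symmetric] by simp
  then have "P (x + a *\<^sub>R u + b *\<^sub>R v) = Q (x + a' *\<^sub>R v + b' *\<^sub>R u)"
    using s by simp
  moreover have "dist (P (x + a *\<^sub>R u + b *\<^sub>R v)) (P x) < e"
    using d1(2)[OF box[OF ab]] close[OF ab] by (simp add: r_def)
  moreover have "dist (Q (x + a' *\<^sub>R v + b' *\<^sub>R u)) (Q x) < e"
    using d2(2)[OF box[OF ab']] close[OF ab'] by (simp add: r_def)
  ultimately show False
    using dist_triangle_half_l[of "P x" "Q (x + a' *\<^sub>R v + b' *\<^sub>R u)" "2 * e" "Q x"]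
    by (simp add: e_def dist_commute flip: dist_real_def)
qed

text \<open>Inner products with basis vectors are bounded linear and commute with both
  differentiations, which reduces the claim to real functions.\<close>

lemma symmetric_second_derivative:
  fixes f :: "'a::real_normed_vector \<Rightarrow> 'b::euclidean_space"
  assumes S: "open S" and x: "x \<in> S" and f: "Ck_on 2 S f"
  shows "frechet_derivative (\<lambda>y. frechet_derivative f (at y) u) (at x) v
       = frechet_derivative (\<lambda>y. frechet_derivative f (at y) v) (at x) u"
proof (rule euclidean_eqI)
  fix b :: 'b
  have d: "\<And>y. y \<in> S \<Longrightarrow> f differentiable at y"
      "\<And>y w. y \<in> S \<Longrightarrow> (\<lambda>y. frechet_derivative f (at y) w) differentiable at y"
    using f by (simp_all add: numeral_2_eq_2)
  have "frechet_derivative (\<lambda>y. frechet_derivative f (at y) w) (at x) w' \<bullet> b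
      = frechet_derivative (\<lambda>y. frechet_derivative (\<lambda>z. f z \<bullet> b) (at y) w) (at x) w'" for w w'
  proof -
    have "frechet_derivative (\<lambda>y. frechet_derivative (\<lambda>z. f z \<bullet> b) (at y) w) (at x)
        = frechet_derivative (\<lambda>y. frechet_derivative f (at y) w \<bullet> b) (at x)"
      by (rule frechet_derivative_cong_open[OF S x])
        (rule frechet_derivative_bounded_linear_compose[OF d(1) bounded_linear_inner_left])
    then show ?thesis
      by (simp only: frechet_derivative_bounded_linear_compose[OF d(2)[OF x] bounded_linear_inner_left])
  qed
  with symmetric_second_derivative_real[OF S x
      Ck_on_bounded_linear_compose[OF S bounded_linear_inner_left f], of b u v]
  show "frechet_derivative (\<lambda>y. frechet_derivative f (at y) u) (at x) v \<bullet> b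
       = frechet_derivative (\<lambda>y. frechet_derivative f (at y) v) (at x) u \<bullet> b"
    by simp
qed

section \<open>Wirtinger derivatives\<close>

lemma smooth_on_const: "smooth_on S (\<lambda>x. c)"
  by (simp add: smooth_on_def Ck_on_const)

lemma smooth_on_bounded_linear: "bounded_linear h \<Longrightarrow> smooth_on S h"
  by (simp add: smooth_on_def Ck_on_bounded_linear)

context
  fixes S :: "'a::real_normed_vector set"
  assumes S: "open S"
begin

lemma smooth_on_cong: "(\<And>x. x \<in> S \<Longrightarrow> f x = g x) \<Longrightarrow> smooth_on S f \<Longrightarrow> smooth_on S g"
  unfolding smooth_on_def using Ck_on_cong[OF S] by blast

lemma smooth_on_bounded_linear_compose:
  "bounded_linear h \<Longrightarrow> smooth_on S f \<Longrightarrow> smooth_on S (\<lambda>x. h (f x))"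
  by (simp add: smooth_on_def Ck_on_bounded_linear_compose S)

lemma smooth_on_cnj: "smooth_on S f \<Longrightarrow> smooth_on S (\<lambda>x. cnj (f x))"
  by (rule smooth_on_bounded_linear_compose[OF bounded_linear_cnj])

lemma smooth_on_minus: "smooth_on S f \<Longrightarrow> smooth_on S (\<lambda>x. - f x)"
  by (rule smooth_on_bounded_linear_compose[OF bounded_linear_minus[OF bounded_linear_ident]])

lemma smooth_on_add: "smooth_on S f \<Longrightarrow> smooth_on S g \<Longrightarrow> smooth_on S (\<lambda>x. f x + g x)"
  by (simp add: smooth_on_def Ck_on_add S)

lemma smooth_on_diff: "smooth_on S f \<Longrightarrow> smooth_on S g \<Longrightarrow> smooth_on S (\<lambda>x. f x - g x)"
  using smooth_on_add[OF _ smooth_on_minus] by (metis (no_types, lifting) add_uminus_conv_diff smooth_on_cong)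

lemma smooth_on_mult:
  fixes f g :: "'a \<Rightarrow> complex"
  shows "smooth_on S f \<Longrightarrow> smooth_on S g \<Longrightarrow> smooth_on S (\<lambda>x. f x * g x)"
  by (simp add: smooth_on_def Ck_on_bilinear[OF S bounded_bilinear_mult])

lemma smooth_on_inverse:
  fixes f :: "'a \<Rightarrow> complex"
  shows "smooth_on S f \<Longrightarrow> (\<And>x. x \<in> S \<Longrightarrow> f x \<noteq> 0) \<Longrightarrow> smooth_on S (\<lambda>x. inverse (f x))"
  by (simp add: smooth_on_def Ck_on_inverse S)

end

text \<open>Common form of the four coordinate derivatives, with \<open>s = -\<i>\<close> for the
  holomorphic and \<open>s = \<i>\<close> for the conjugate ones, so that the rules of calculus are
  proved once.\<close>

definition wirtinger :: "complex \<Rightarrow> 'a \<Rightarrow> 'a \<Rightarrow> ('a::real_normed_vector \<Rightarrow> complex) \<Rightarrow> 'a \<Rightarrow> complex" where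
  "wirtinger s u v f x = (frechet_derivative f (at x) u + s * frechet_derivative f (at x) v) / 2"

definition is_wirtinger :: "(('a::real_normed_vector \<Rightarrow> complex) \<Rightarrow> 'a \<Rightarrow> complex) \<Rightarrow> bool" where
  "is_wirtinger d \<longleftrightarrow> (\<exists>s u v. d = wirtinger s u v)"

context
  fixes d :: "('a::real_normed_vector \<Rightarrow> complex) \<Rightarrow> 'a \<Rightarrow> complex" and S :: "'a set"
  assumes d: "is_wirtinger d" and S: "open S"
begin

lemma wirtinger_cong:
  assumes "x \<in> S" "\<And>y. y \<in> S \<Longrightarrow> f y = g y"
  shows "d f x = d g x"
  using d frechet_derivative_cong_open[OF S assms] by (auto simp: is_wirtinger_def wirtinger_def)

lemma smooth_on_wirtinger:
  assumes "smooth_on S f"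
  shows "smooth_on S (d f)"
proof -
  obtain s u v where *: "d = wirtinger s u v" using d by (auto simp: is_wirtinger_def)
  have "smooth_on S (\<lambda>x. (frechet_derivative f (at x) u + s * frechet_derivative f (at x) v) * (1/2))"
    by (intro smooth_on_mult smooth_on_add S smooth_on_const smooth_on_frechet_derivative assms)
  then show ?thesis
    by (rule smooth_on_cong[OF S, rotated]) (simp add: * wirtinger_def)
qed

lemma wirtinger_const: "d (\<lambda>x. c) x = 0"
  using d by (auto simp: is_wirtinger_def wirtinger_def)

lemma wirtinger_add:
  "smooth_on S f \<Longrightarrow> smooth_on S g \<Longrightarrow> x \<in> S \<Longrightarrow> d (\<lambda>x. f x + g x) x = d f x + d g x"
  using d by (auto simp: is_wirtinger_def wirtinger_def frechet_derivative_add
      smooth_on_differentiable field_simps)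

lemma wirtinger_minus:
  "smooth_on S f \<Longrightarrow> x \<in> S \<Longrightarrow> d (\<lambda>x. - f x) x = - d f x"
  using d by (auto simp: is_wirtinger_def wirtinger_def smooth_on_differentiable field_simps
      frechet_derivative_bounded_linear_compose[OF _ bounded_linear_minus[OF bounded_linear_ident]])

lemma wirtinger_diff:
  assumes "smooth_on S f" "smooth_on S g" "x \<in> S"
  shows "d (\<lambda>x. f x - g x) x = d f x - d g x"
  using wirtinger_add[OF assms(1) smooth_on_minus[OF S assms(2)] assms(3)]
    wirtinger_minus[OF assms(2,3)] by simp

lemma wirtinger_mult:
  "smooth_on S f \<Longrightarrow> smooth_on S g \<Longrightarrow> x \<in> S \<Longrightarrow>
    d (\<lambda>x. f x * g x) x = d f x * g x + f x * d g x"
  using d by (auto simp: is_wirtinger_def wirtinger_def smooth_on_differentiable field_simps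
      frechet_derivative_bilinear[OF _ _ bounded_bilinear_mult])

text \<open>Each operator is a fixed linear combination of two directional derivatives, so the
  symmetry of second derivatives applies term by term.\<close>

lemma wirtinger_commute:
  assumes "is_wirtinger d'" "smooth_on S f" "x \<in> S"
  shows "d (d' f) x = d' (d f) x"
proof -
  obtain s u v where *: "d = wirtinger s u v" using d by (auto simp: is_wirtinger_def)
  obtain s' u' v' where **: "d' = wirtinger s' u' v'" using assms(1) by (auto simp: is_wirtinger_def)
  note diff = smooth_on_differentiable[OF smooth_on_frechet_derivative[OF assms(2)] assms(3)]
  have expand: "frechet_derivative (wirtinger s u v f) (at x) w
     = (frechet_derivative (\<lambda>x. frechet_derivative f (at x) u) (at x) w
       + s * frechet_derivative (\<lambda>x. frechet_derivative f (at x) v) (at x) w) / 2" for s u v w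
  proof -
    have "((\<lambda>x. (frechet_derivative f (at x) u + s * frechet_derivative f (at x) v) / 2) has_derivative
      (\<lambda>w. (frechet_derivative (\<lambda>x. frechet_derivative f (at x) u) (at x) w
       + s * frechet_derivative (\<lambda>x. frechet_derivative f (at x) v) (at x) w) / 2)) (at x)"
      by (intro bounded_linear.has_derivative[OF bounded_linear_divide] has_derivative_add
          has_derivative_mult_right frechet_derivative_works[THEN iffD1] diff)
    then show ?thesis
      using frechet_derivative_at by (auto simp: wirtinger_def[abs_def] dest!: frechet_derivative_at fun_cong[of _ _ w])
  qed
  have sym: "frechet_derivative (\<lambda>y. frechet_derivative f (at y) a) (at x) b
       = frechet_derivative (\<lambda>y. frechet_derivative f (at y) b) (at x) a" for a b
    by (rule symmetric_second_derivative[OF S assms(3)]) (use assms(2) in \<open>simp add: smooth_on_def\<close>)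
  show ?thesis
    unfolding * ** by (simp add: wirtinger_def[of _ _ _ "wirtinger _ _ _ f"] expand sym[of u] sym[of v])
      (simp add: field_simps)
qed

end

section \<open>Coordinate derivatives along base and fibre\<close>

lemma is_wirtinger_z: "is_wirtinger (d_z k)"
proof -
  have "d_z k = wirtinger (-\<i>) (axis k 1, 0) (axis k \<i>, 0)"
    by (simp add: fun_eq_iff d_z_def wirtinger_def)
  then show ?thesis unfolding is_wirtinger_def by blast
qed

lemma is_wirtinger_zbar: "is_wirtinger (d_zbar k)"
proof -
  have "d_zbar k = wirtinger \<i> (axis k 1, 0) (axis k \<i>, 0)"
    by (simp add: fun_eq_iff d_zbar_def wirtinger_def)
  then show ?thesis unfolding is_wirtinger_def by blast
qed

lemma is_wirtinger_eta: "is_wirtinger (d_eta k)"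
proof -
  have "d_eta k = wirtinger (-\<i>) (0, axis k 1) (0, axis k \<i>)"
    by (simp add: fun_eq_iff d_eta_def wirtinger_def)
  then show ?thesis unfolding is_wirtinger_def by blast
qed

lemma is_wirtinger_etabar: "is_wirtinger (d_etabar k)"
proof -
  have "d_etabar k = wirtinger \<i> (0, axis k 1) (0, axis k \<i>)"
    by (simp add: fun_eq_iff d_etabar_def wirtinger_def)
  then show ?thesis unfolding is_wirtinger_def by blast
qed

lemmas is_wirtinger = is_wirtinger_z is_wirtinger_zbar is_wirtinger_eta is_wirtinger_etabar

lemma
  assumes "f differentiable at x"
  shows d_z_cnj: "d_z k (\<lambda>x. cnj (f x)) x = cnj (d_zbar k f x)"
    and d_zbar_cnj: "d_zbar k (\<lambda>x. cnj (f x)) x = cnj (d_z k f x)"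
    and d_eta_cnj: "d_eta k (\<lambda>x. cnj (f x)) x = cnj (d_etabar k f x)"
    and d_etabar_cnj: "d_etabar k (\<lambda>x. cnj (f x)) x = cnj (d_eta k f x)"
  using frechet_derivative_bounded_linear_compose[OF assms bounded_linear_cnj]
  by (simp_all add: d_z_def d_zbar_def d_eta_def d_etabar_def)

lemma bounded_linear_fibre_coordinate: "bounded_linear (\<lambda>x. snd x $ j)"
  by (rule bounded_linear_compose[OF bounded_linear_vec_nth bounded_linear_snd])

lemma frechet_derivative_fibre_coordinate:
  "frechet_derivative (\<lambda>x. snd x $ j) (at x) v = snd v $ j"
  using frechet_derivative_at[OF bounded_linear_imp_has_derivative[OF bounded_linear_fibre_coordinate]]
  by metis

lemma
  shows d_z_fibre_coordinate: "d_z k (\<lambda>x. snd x $ j) x = 0"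
    and d_zbar_fibre_coordinate: "d_zbar k (\<lambda>x. snd x $ j) x = 0"
    and d_eta_fibre_coordinate: "d_eta k (\<lambda>x. snd x $ j) x = (if j = k then 1 else 0)"
    and d_etabar_fibre_coordinate: "d_etabar k (\<lambda>x. snd x $ j) x = 0"
  by (simp_all add: d_z_def d_zbar_def d_eta_def d_etabar_def frechet_derivative_fibre_coordinate axis_def)

text \<open>For a real-valued function the conjugate derivatives vanish along with the holomorphic
  ones, hence so do the derivatives along a real basis.\<close>

lemma frechet_derivative_eq_0:
  assumes "f differentiable at x" "\<And>y. cnj (f y) = f y"
    "\<And>k. d_z k f x = 0" "\<And>k. d_eta k f x = 0"
  shows "frechet_derivative f (at x) = (\<lambda>v. 0)"
proof
  fix v :: "(complex^2) \<times> (complex^2)"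
  let ?D = "frechet_derivative f (at x)"
  have "(\<lambda>x. cnj (f x)) = f" using assms(2) by auto
  then have "d_zbar k f x = 0" "d_etabar k f x = 0" for k
    using d_zbar_cnj[OF assms(1), of k] d_etabar_cnj[OF assms(1), of k] assms(3,4) by simp_all
  moreover have "a = 0 \<and> b = 0" if "(a - \<i> * b) / 2 = 0" "(a + \<i> * b) / 2 = 0" for a b
  proof -
    have "2 * a = (a - \<i> * b) + (a + \<i> * b)" by simp
    with that show ?thesis by simp
  qed
  ultimately have b: "?D (axis k 1, 0) = 0 \<and> ?D (axis k \<i>, 0) = 0
      \<and> ?D (0, axis k 1) = 0 \<and> ?D (0, axis k \<i>) = 0" for k
    using assms(3,4) unfolding d_z_def d_zbar_def d_eta_def d_etabar_def by blast
  have lin: "linear ?D" by (rule linear_frechet_derivative[OF assms(1)])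
  have axis: "axis k c = Re c *\<^sub>R axis k (1::complex) + Im c *\<^sub>R axis k \<i>" for k :: 2 and c
    by (simp add: vec_eq_iff axis_def complex_eq_iff)
  have "w = axis 1 (w $ 1) + axis 2 (w $ 2)" for w :: "complex^2"
    by (simp add: vec_eq_iff axis_def forall_2)
  then have "v = (axis 1 (fst v $ 1), 0) + (axis 2 (fst v $ 2), 0)
      + (0, axis 1 (snd v $ 1)) + (0, axis 2 (snd v $ 2))"
    by (simp add: prod_eq_iff)
  moreover have "?D (axis k c, 0) = 0" for k c
  proof -
    have "(axis k c, 0) = Re c *\<^sub>R (axis k 1, 0) + Im c *\<^sub>R (axis k \<i>, 0::complex^2)"
      using axis[of k c] by (simp add: prod_eq_iff)
    then show ?thesis
      using b[of k] by (simp only: linear_add[OF lin] linear_scale[OF lin]) simp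
  qed
  moreover have "?D (0, axis k c) = 0" for k c
  proof -
    have "(0, axis k c) = Re c *\<^sub>R (0, axis k 1) + Im c *\<^sub>R (0::complex^2, axis k \<i>)"
      using axis[of k c] by (simp add: prod_eq_iff)
    then show ?thesis
      using b[of k] by (simp only: linear_add[OF lin] linear_scale[OF lin]) simp
  qed
  ultimately show "?D v = 0"
    using lin by (metis (no_types, lifting) add_0 linear_add)
qed

locale smooth_domain =
  fixes S :: "((complex^2) \<times> (complex^2)) set"
  assumes open_S: "open S"
begin

lemmas smooth [simp, intro] = smooth_on_const[of S] smooth_on_cnj[OF open_S]
  smooth_on_minus[OF open_S] smooth_on_add[OF open_S] smooth_on_diff[OF open_S]
  smooth_on_mult[OF open_S] smooth_on_bounded_linear[OF bounded_linear_fibre_coordinate, of S]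
  is_wirtinger[THEN smooth_on_wirtinger, OF open_S]

lemmas d_cong = is_wirtinger[THEN wirtinger_cong, OF open_S]
lemmas d_commute = is_wirtinger[THEN wirtinger_commute, OF open_S]

lemma d_simps [simp]:
  assumes "smooth_on S f" "x \<in> S"
  shows d_z_minus: "d_z k (\<lambda>x. - f x) x = - d_z k f x"
    and "d_zbar k (\<lambda>x. - f x) x = - d_zbar k f x"
    and "d_eta k (\<lambda>x. - f x) x = - d_eta k f x"
    and "d_etabar k (\<lambda>x. - f x) x = - d_etabar k f x"
    and "d_z k (\<lambda>x. cnj (f x)) x = cnj (d_zbar k f x)"
    and "d_zbar k (\<lambda>x. cnj (f x)) x = cnj (d_z k f x)"
    and "d_eta k (\<lambda>x. cnj (f x)) x = cnj (d_etabar k f x)"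
    and "d_etabar k (\<lambda>x. cnj (f x)) x = cnj (d_eta k f x)"
  using assms smooth_on_differentiable[OF assms]
  by (simp_all add: is_wirtinger[THEN wirtinger_minus, OF open_S]
      d_z_cnj d_zbar_cnj d_eta_cnj d_etabar_cnj)

lemmas [simp] = is_wirtinger[THEN wirtinger_const, OF open_S]
  is_wirtinger[THEN wirtinger_add, OF open_S]
  is_wirtinger[THEN wirtinger_diff, OF open_S]
  is_wirtinger[THEN wirtinger_mult, OF open_S]
  d_z_fibre_coordinate d_zbar_fibre_coordinate d_eta_fibre_coordinate d_etabar_fibre_coordinate

end

section \<open>Local geometry\<close>

lemma matrix_inv:
  fixes G :: "'a::field^'n^'n"
  assumes "det G \<noteq> 0"
  shows "G ** matrix_inv G = mat 1 \<and> matrix_inv G ** G = mat 1"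
  using assms unfolding matrix_inv_def invertible_det_nz[symmetric] invertible_def by (rule someI_ex)

text \<open>A kernel vector of the transpose would be a nonzero vector on which the Hermitian form
  vanishes; the transpose appears because \<open>w\<close> is paired with the first index of
  \<open>G\<close>.\<close>

lemma hermitian_pos_def_det:
  assumes "hermitian_pos_def G"
  shows "det G \<noteq> 0"
proof
  assume "det G = 0"
  then have "\<not> invertible (transpose G)" by (simp add: invertible_det_nz)
  then obtain w where w: "w \<noteq> 0" "transpose G *v w = 0"
    using matrix_left_invertible_ker invertible_left_inverse by blast
  have "(\<Sum>i\<in>UNIV. \<Sum>j\<in>UNIV. G $ i $ j * w $ i * cnj (w $ j))
      = (\<Sum>j\<in>UNIV. (transpose G *v w) $ j * cnj (w $ j))"
    by (simp add: matrix_vector_mult_def transpose_def sum_2 algebra_simps)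
  moreover have "0 < Re (\<Sum>i\<in>UNIV. \<Sum>j\<in>UNIV. G $ i $ j * w $ i * cnj (w $ j))"
    using assms w(1) unfolding hermitian_pos_def_def by blast
  ultimately show False by (simp only: w(2)) simp
qed

text \<open>The geometry in one chart. Homogeneity of \<open>L\<close> enters in its infinitesimal
  form \<open>euler\<close>; the identities for higher derivatives arise by differentiating
  it.\<close>

locale local_finsler = smooth_domain +
  fixes L :: cfun
  assumes smooth_L [simp, intro]: "smooth_on S L"
    and real_L: "cnj (L x) = L x"
    and slit: "x \<in> S \<Longrightarrow> snd x \<noteq> 0"
    and pos_def: "x \<in> S \<Longrightarrow> hermitian_pos_def (g_matrix L x)"
    and euler: "x \<in> S \<Longrightarrow> (\<Sum>k\<in>UNIV. snd x $ k * d_eta k L x) = L x"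
begin

abbreviation "g \<equiv> g_lower L"
abbreviation "N \<equiv> CF_N L"

section \<open>The metric and its inverse\<close>

lemma smooth_g [simp, intro]: "smooth_on S (g i j)"
  by (simp add: g_lower_def)

lemma g_cnj:
  assumes "x \<in> S"
  shows "cnj (g i j x) = g j i x"
proof -
  have "g_matrix L x $ j $ i = cnj (g_matrix L x $ i $ j)"
    using pos_def[OF assms] unfolding hermitian_pos_def_def by blast
  then show ?thesis by (simp add: g_matrix_def)
qed

lemma g_left_inverse:
  assumes "x \<in> S"
  shows "(\<Sum>i\<in>UNIV. g_upper L m i x * g i r x) = (if m = r then 1 else 0)"
proof -
  have "matrix_inv (g_matrix L x) ** g_matrix L x = mat 1"
    by (rule matrix_inv[OF hermitian_pos_def_det[OF pos_def[OF assms]], THEN conjunct2])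
  then have "(matrix_inv (g_matrix L x) ** g_matrix L x) $ m $ r = mat 1 $ m $ r" by simp
  then show ?thesis
    by (simp add: matrix_matrix_mult_def mat_def g_upper_def g_matrix_def)
qed

lemma g_right_inverse:
  assumes "x \<in> S"
  shows "(\<Sum>m\<in>UNIV. g i m x * g_upper L m k x) = (if i = k then 1 else 0)"
proof -
  have "g_matrix L x ** matrix_inv (g_matrix L x) = mat 1"
    by (rule matrix_inv[OF hermitian_pos_def_det[OF pos_def[OF assms]], THEN conjunct1])
  then have "(g_matrix L x ** matrix_inv (g_matrix L x)) $ i $ k = mat 1 $ i $ k" by simp
  then show ?thesis
    by (simp add: matrix_matrix_mult_def mat_def g_upper_def g_matrix_def)
qed

lemma g_raise:
  assumes "x \<in> S" "\<And>r. (\<Sum>i\<in>UNIV. g i r x * X i) = Y r"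
  shows "X i = (\<Sum>r\<in>UNIV. g_upper L r i x * Y r)"
proof -
  have "(\<Sum>r\<in>UNIV. g_upper L r i x * (\<Sum>j\<in>UNIV. g j r x * X j))
      = (\<Sum>j\<in>UNIV. (\<Sum>r\<in>UNIV. g j r x * g_upper L r i x) * X j)"
    by (simp add: sum_2 algebra_simps)
  also have "\<dots> = X i" by (simp add: g_right_inverse[OF assms(1)] mult_delta_left)
  finally show ?thesis using assms(2) by simp
qed

lemma g_cancel:
  assumes "x \<in> S" "\<And>r. (\<Sum>i\<in>UNIV. g i r x * X i) = (\<Sum>i\<in>UNIV. g i r x * Y i)"
  shows "X i = Y i"
  using g_raise[OF assms(1), of X "\<lambda>r. \<Sum>i\<in>UNIV. g i r x * Y i" i] assms(2)
    g_raise[OF assms(1), of Y "\<lambda>r. \<Sum>i\<in>UNIV. g i r x * Y i" i] by simp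

lemma g_cancel_zero:
  assumes "x \<in> S" "\<And>r. (\<Sum>i\<in>UNIV. g i r x * X i) = 0"
  shows "X i = 0"
  using g_raise[OF assms, of i] by simp

lemma g_lower_g_upper:
  assumes "x \<in> S"
  shows "(\<Sum>i\<in>UNIV. g i r x * (\<Sum>m\<in>UNIV. g_upper L m i x * Y m)) = Y r"
proof -
  have "(\<Sum>i\<in>UNIV. g i r x * (\<Sum>m\<in>UNIV. g_upper L m i x * Y m))
     = (\<Sum>m\<in>UNIV. (\<Sum>i\<in>UNIV. g_upper L m i x * g i r x) * Y m)"
    by (simp add: sum_2 algebra_simps)
  also have "\<dots> = Y r" by (simp add: g_left_inverse[OF assms(1)] mult_delta_left)
  finally show ?thesis .
qed

abbreviation "detg x \<equiv> g 1 1 x * g 2 2 x - g 1 2 x * g 2 1 x"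

lemma detg_nonzero: "x \<in> S \<Longrightarrow> detg x \<noteq> 0"
  using hermitian_pos_def_det[OF pos_def] by (simp add: det_2 g_matrix_def)

text \<open>By Cramer's rule the inverse is the adjugate over the determinant, which exhibits its
  entries as smooth functions.\<close>

lemma smooth_g_upper [simp, intro]: "smooth_on S (g_upper L m i)"
proof -
  \<comment> \<open>Arithmetic in the type \<open>2\<close> is modulo two, so \<open>3 - m\<close>
    is the other index.\<close>
  define adj where "adj m i x = (if m = i then g (3 - m) (3 - m) x else - g m i x)" for m i :: 2 and x
  have "g_upper L m i x = adj m i x * inverse (detg x)" if "x \<in> S" for x
  proof -
    have "(\<Sum>k\<in>UNIV. (\<Sum>r\<in>UNIV. g_upper L m r x * g r k x) * adj k i x) = adj m i x"
      by (simp add: g_left_inverse[OF that] mult_delta_left)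
    moreover have "(\<Sum>k\<in>UNIV. (\<Sum>r\<in>UNIV. g_upper L m r x * g r k x) * adj k i x)
       = g_upper L m i x * detg x"
      using exhaust_2[of i] unfolding sum_2 adj_def by (auto simp: algebra_simps)
    ultimately have "g_upper L m i x * detg x = adj m i x" by simp
    then show ?thesis using detg_nonzero[OF that] by (simp add: field_simps)
  qed
  moreover have "smooth_on S (\<lambda>x. inverse (detg x))"
    by (rule smooth_on_inverse[OF open_S _ detg_nonzero]) simp
  then have "smooth_on S (\<lambda>x. adj m i x * inverse (detg x))"
    by (cases "m = i") (simp_all add: adj_def)
  ultimately show ?thesis
    using smooth_on_cong[OF open_S, of "\<lambda>x. adj m i x * inverse (detg x)" "g_upper L m i"] by simp
qed

lemma smooth_N [simp, intro]: "smooth_on S (N k j)"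
proof -
  have "N k j = (\<lambda>x. \<Sum>m\<in>UNIV. \<Sum>l\<in>UNIV. g_upper L m k x * d_z j (g l m) x * snd x $ l)"
    by (simp add: CF_N_def fun_eq_iff)
  then show ?thesis by (simp add: sum_2)
qed

section \<open>Euler identities for \<open>L\<close> and its fibre derivatives\<close>

lemma euler_bar: "x \<in> S \<Longrightarrow> (\<Sum>k\<in>UNIV. cnj (snd x $ k) * d_etabar k L x) = L x"
proof -
  assume x: "x \<in> S"
  have "(\<lambda>x. cnj (L x)) = L" by (simp add: real_L fun_eq_iff)
  then have "d_etabar k L x = cnj (d_eta k L x)" for k
    using d_simps(8)[OF smooth_L x, of k] by simp
  then show ?thesis using arg_cong[OF euler[OF x], of cnj] real_L by (simp add: sum_2)
qed

lemma eta_g: "x \<in> S \<Longrightarrow> (\<Sum>k\<in>UNIV. snd x $ k * g k m x) = d_etabar m L x"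
  using d_cong(4)[of x "\<lambda>x. \<Sum>k\<in>UNIV. snd x $ k * d_eta k L x" L m] euler
  by (simp add: sum_2 g_lower_def d_commute[OF is_wirtinger_eta])

lemma etabar_g: "x \<in> S \<Longrightarrow> (\<Sum>k\<in>UNIV. cnj (snd x $ k) * g m k x) = d_eta m L x"
  using d_cong(3)[of x "\<lambda>x. \<Sum>k\<in>UNIV. cnj (snd x $ k) * d_etabar k L x" L m] euler_bar
  by (simp add: sum_2 g_lower_def)

text \<open>Contracting \<open>g\<close> by both Euler identities gives back \<open>L\<close>, which
  is therefore the value of a definite form at the nonzero vector \<open>snd x\<close>.\<close>

lemma L_nonzero:
  assumes "x \<in> S"
  shows "L x \<noteq> 0"
proof -
  have "0 < Re (\<Sum>i\<in>UNIV. \<Sum>j\<in>UNIV. g_matrix L x $ i $ j * snd x $ i * cnj (snd x $ j))"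
    using pos_def[OF assms] slit[OF assms] unfolding hermitian_pos_def_def by blast
  moreover have "(\<Sum>i\<in>UNIV. \<Sum>j\<in>UNIV. g_matrix L x $ i $ j * snd x $ i * cnj (snd x $ j))
      = (\<Sum>k\<in>UNIV. cnj (snd x $ k) * (\<Sum>i\<in>UNIV. snd x $ i * g i k x))"
    by (simp add: sum_2 g_matrix_def algebra_simps)
  ultimately show ?thesis by (auto simp: eta_g[OF assms] euler_bar[OF assms])
qed

lemma d_eta_g_sym: "x \<in> S \<Longrightarrow> d_eta k (g j r) x = d_eta j (g k r) x"
  by (simp add: g_lower_def d_commute[OF is_wirtinger_eta])

lemma d_etabar_g_sym: "x \<in> S \<Longrightarrow> d_etabar k (g j r) x = d_etabar r (g j k) x"
  using d_cong(3)[of x "d_etabar k (d_etabar r L)" "d_etabar r (d_etabar k L)" j]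
  by (simp add: g_lower_def d_commute(4)[OF is_wirtinger_eta] d_commute(4)[OF is_wirtinger_etabar])

lemma d_etabar_L_eta: "x \<in> S \<Longrightarrow> d_etabar r (d_eta m L) x = g m r x"
  by (simp add: g_lower_def d_commute[OF is_wirtinger_eta])

text \<open>The metric has degree zero in \<eta>: differentiating \<open>eta_g\<close> once more
  reproduces \<open>g\<close> from the factor \<eta>, so the remaining sum vanishes.\<close>

lemma eta_d_eta_g:
  assumes "x \<in> S"
  shows "(\<Sum>k\<in>UNIV. snd x $ k * d_eta k (g j m) x) = 0"
proof -
  have "d_eta j (\<lambda>x. \<Sum>k\<in>UNIV. snd x $ k * g k m x) x = g j m x"
    using d_cong(3)[OF assms eta_g] by (simp add: g_lower_def)
  then have "(\<Sum>k\<in>UNIV. snd x $ k * d_eta j (g k m) x) = 0"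
    using exhaust_2[of j] assms by (auto simp: sum_2)
  then show ?thesis by (simp add: d_eta_g_sym[OF assms, of _ j])
qed

lemma etabar_d_eta_g:
  "x \<in> S \<Longrightarrow> (\<Sum>m\<in>UNIV. cnj (snd x $ m) * d_eta k (g i m) x) = d_eta k (d_eta i L) x"
  using d_cong(3)[of x "\<lambda>x. \<Sum>m\<in>UNIV. cnj (snd x $ m) * g i m x" "d_eta i L" k] etabar_g
  by (simp add: sum_2)

lemma etabar_d_etabar_g:
  assumes "x \<in> S"
  shows "(\<Sum>m\<in>UNIV. cnj (snd x $ m) * d_etabar m (g i r) x) = 0"
proof -
  have "d_etabar r (\<lambda>x. \<Sum>m\<in>UNIV. cnj (snd x $ m) * g i m x) x = g i r x"
    using d_cong(4)[OF assms etabar_g] assms by (simp add: d_etabar_L_eta)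
  then have "(\<Sum>m\<in>UNIV. cnj (snd x $ m) * d_etabar r (g i m) x) = 0"
    using exhaust_2[of r] assms by (auto simp: sum_2)
  then show ?thesis by (simp add: d_etabar_g_sym[OF assms, of _ i r])
qed

text \<open>The first derivatives of \<open>L\<close> in \<eta> have degree zero in \<eta>.\<close>

lemma eta_d_eta_eta_L: "x \<in> S \<Longrightarrow> (\<Sum>k\<in>UNIV. snd x $ k * d_eta j (d_eta k L) x) = 0"
  using d_cong(3)[of x "\<lambda>x. \<Sum>k\<in>UNIV. snd x $ k * d_eta k L x" L j] euler exhaust_2[of j]
  by (auto simp: sum_2)

lemma etabar_d_etabar_etabar_L:
  "x \<in> S \<Longrightarrow> (\<Sum>k\<in>UNIV. cnj (snd x $ k) * d_etabar j (d_etabar k L) x) = 0"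
  using d_cong(4)[of x "\<lambda>x. \<Sum>k\<in>UNIV. cnj (snd x $ k) * d_etabar k L x" L j] euler_bar exhaust_2[of j]
  by (auto simp: sum_2)

section \<open>Homogeneity and fibre derivatives of the connection coefficients\<close>

lemma eta_d_z_g:
  assumes "x \<in> S"
  shows "(\<Sum>l\<in>UNIV. snd x $ l * d_z k (g l m) x) = d_z k (d_etabar m L) x"
proof -
  have "d_z k (\<lambda>x. \<Sum>l\<in>UNIV. snd x $ l * g l m x) x = d_z k (d_etabar m L) x"
    by (rule d_cong(1)[OF assms eta_g])
  then show ?thesis using assms by (simp add: sum_2)
qed

text \<open>Contraction with \<eta> turns the derivative of the metric into a mixed derivative of
  \<open>L\<close>; this lowered form keeps the inverse matrix out of later
  differentiations.\<close>

lemma g_N: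
  assumes "x \<in> S"
  shows "(\<Sum>i\<in>UNIV. g i r x * N i k x) = d_z k (d_etabar r L) x"
proof -
  have "N i k x = (\<Sum>m\<in>UNIV. g_upper L m i x * (\<Sum>l\<in>UNIV. snd x $ l * d_z k (g l m) x))" for i
    by (simp add: CF_N_def sum_2 algebra_simps)
  then show ?thesis by (simp add: eta_d_z_g g_lower_g_upper assms)
qed

text \<open>Differentiate \<open>g_N\<close> along the fibre: by the symmetry of third derivatives,
  the term that differentiates \<open>g\<close> is exactly the vertical correction in
  \<open>delta\<close>.\<close>

lemma g_d_eta_N:
  assumes "x \<in> S"
  shows "(\<Sum>i\<in>UNIV. g i r x * d_eta j (N i k) x) = delta L k (g j r) x"
proof -
  have "d_eta j (\<lambda>x. \<Sum>i\<in>UNIV. g i r x * N i k x) x = d_z k (g j r) x"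
    using d_cong(3)[OF assms g_N] assms by (simp add: d_commute(3)[OF is_wirtinger_z] g_lower_def)
  then show ?thesis
    using assms d_eta_g_sym[OF assms, of j 1 r] d_eta_g_sym[OF assms, of j 2 r]
    by (simp add: sum_2 delta_def algebra_simps)
qed

text \<open>Raising the index in \<open>g_d_eta_N\<close> identifies the horizontal coefficients
  with fibre derivatives of \<open>N\<close>, so the curvature becomes an expression in derivatives
  of \<open>N\<close>.\<close>

lemma CF_L_eq: "x \<in> S \<Longrightarrow> CF_L L i j k x = d_eta j (N i k) x"
  using g_raise[of x "\<lambda>i. d_eta j (N i k) x", OF _ g_d_eta_N] by (simp add: CF_L_def)

lemma g_CF_C: "x \<in> S \<Longrightarrow> (\<Sum>i\<in>UNIV. g i r x * CF_C L i j k x) = d_eta k (g j r) x"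
  by (simp add: CF_C_def g_lower_g_upper)

lemma CF_C_sym: "x \<in> S \<Longrightarrow> CF_C L i j k x = CF_C L i k j x"
  by (simp add: CF_C_def d_eta_g_sym[of x k j])

lemma eta_CF_C:
  assumes "x \<in> S"
  shows "(\<Sum>k\<in>UNIV. snd x $ k * CF_C L i j k x) = 0"
proof -
  have "(\<Sum>k\<in>UNIV. snd x $ k * CF_C L i j k x)
     = (\<Sum>l\<in>UNIV. g_upper L l i x * (\<Sum>k\<in>UNIV. snd x $ k * d_eta k (g j l) x))"
    by (simp add: CF_C_def sum_2 algebra_simps)
  then show ?thesis by (simp add: eta_d_eta_g assms)
qed

text \<open>The coefficients have degree one in \<eta>: after lowering, the vertical part of
  \<open>delta\<close> drops out because \<open>g\<close> has degree zero.\<close>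

lemma eta_d_eta_N:
  assumes "x \<in> S"
  shows "(\<Sum>j\<in>UNIV. snd x $ j * d_eta j (N i k) x) = N i k x"
proof (rule g_cancel[OF assms,
      where X = "\<lambda>i. \<Sum>j\<in>UNIV. snd x $ j * d_eta j (N i k) x" and Y = "\<lambda>i. N i k x"])
  fix r
  have "(\<Sum>i\<in>UNIV. g i r x * (\<Sum>j\<in>UNIV. snd x $ j * d_eta j (N i k) x))
      = (\<Sum>j\<in>UNIV. snd x $ j * (\<Sum>i\<in>UNIV. g i r x * d_eta j (N i k) x))"
    by (simp add: sum_2 algebra_simps)
  also have "\<dots> = (\<Sum>j\<in>UNIV. snd x $ j * delta L k (g j r) x)"
    by (simp add: g_d_eta_N assms)
  also have "\<dots> = (\<Sum>j\<in>UNIV. snd x $ j * d_z k (g j r) x)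
      - (\<Sum>l\<in>UNIV. N l k x * (\<Sum>j\<in>UNIV. snd x $ j * d_eta j (g l r) x))"
    by (simp add: delta_def sum_2 algebra_simps d_eta_g_sym[OF assms, of 1 2])
  also have "\<dots> = d_z k (d_etabar r L) x"
    by (simp add: eta_d_eta_g eta_d_z_g assms)
  finally show "(\<Sum>i\<in>UNIV. g i r x * (\<Sum>j\<in>UNIV. snd x $ j * d_eta j (N i k) x))
     = (\<Sum>i\<in>UNIV. g i r x * N i k x)"
    by (simp add: g_N assms)
qed

lemma g_d_etabar_N:
  assumes "x \<in> S"
  shows "(\<Sum>i\<in>UNIV. g i r x * d_etabar l (N i k) x)
    = d_z k (d_etabar l (d_etabar r L)) x - (\<Sum>i\<in>UNIV. d_etabar l (g i r) x * N i k x)"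
proof -
  have "d_etabar l (\<lambda>x. \<Sum>i\<in>UNIV. g i r x * N i k x) x = d_z k (d_etabar l (d_etabar r L)) x"
    using d_cong(4)[OF assms g_N] assms by (simp add: d_commute(4)[OF is_wirtinger_z])
  then show ?thesis
    using assms by (simp add: sum_2 algebra_simps)
qed

text \<open>The coefficients have degree zero in the conjugate of \<eta>: after lowering, both terms
  of \<open>g_d_etabar_N\<close> vanish by conjugate homogeneity.\<close>

lemma etabar_d_etabar_N:
  assumes "x \<in> S"
  shows "(\<Sum>m\<in>UNIV. cnj (snd x $ m) * d_etabar m (N i k) x) = 0"
proof (rule g_cancel_zero[OF assms,
      where X = "\<lambda>i. \<Sum>m\<in>UNIV. cnj (snd x $ m) * d_etabar m (N i k) x"])
  fix r
  have comm: "d_z k (d_etabar m (d_etabar r L)) x = d_z k (d_etabar r (d_etabar m L)) x" for m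
    by (rule d_cong(1)[OF assms d_commute(4)[OF is_wirtinger_etabar smooth_L]])
  have "(\<Sum>i\<in>UNIV. g i r x * (\<Sum>m\<in>UNIV. cnj (snd x $ m) * d_etabar m (N i k) x))
      = (\<Sum>m\<in>UNIV. cnj (snd x $ m) * (\<Sum>i\<in>UNIV. g i r x * d_etabar m (N i k) x))"
    by (simp add: sum_2 algebra_simps)
  also have "\<dots> = (\<Sum>m\<in>UNIV. cnj (snd x $ m) * d_z k (d_etabar m (d_etabar r L)) x)
      - (\<Sum>i\<in>UNIV. (\<Sum>m\<in>UNIV. cnj (snd x $ m) * d_etabar m (g i r) x) * N i k x)"
    by (simp add: g_d_etabar_N assms) (simp add: sum_2 algebra_simps)
  also have "\<dots> = (\<Sum>m\<in>UNIV. cnj (snd x $ m) * d_z k (d_etabar r (d_etabar m L)) x)"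
    by (simp add: etabar_d_etabar_g assms comm)
  also have "\<dots> = 0"
    using d_cong(1)[of x "\<lambda>x. \<Sum>m\<in>UNIV. cnj (snd x $ m) * d_etabar r (d_etabar m L) x" "\<lambda>x. 0" k]
      etabar_d_etabar_etabar_L assms
    by (simp add: sum_2)
  finally show "(\<Sum>i\<in>UNIV. g i r x * (\<Sum>m\<in>UNIV. cnj (snd x $ m) * d_etabar m (N i k) x)) = 0" .
qed

end

lemma (in local_finsler) smooth_delta_bar [simp, intro]:
  assumes "smooth_on S f"
  shows "smooth_on S (delta_bar L k f)"
proof -
  have "delta_bar L k f = (\<lambda>x. d_zbar k f x - (\<Sum>j\<in>UNIV. cnj (N j k x) * d_etabar j f x))"
    by (simp add: delta_bar_def fun_eq_iff)
  then show ?thesis using assms by (simp add: sum_2)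
qed

lemma (in local_finsler) smooth_CF_C [simp, intro]: "smooth_on S (CF_C L i j k)"
proof -
  have "CF_C L i j k = (\<lambda>x. \<Sum>l\<in>UNIV. g_upper L l i x * d_eta k (g j l) x)"
    by (simp add: CF_C_def fun_eq_iff)
  then show ?thesis by (simp add: sum_2)
qed

lemma (in local_finsler) delta_bar_cong:
  "x \<in> S \<Longrightarrow> (\<And>y. y \<in> S \<Longrightarrow> f y = h y) \<Longrightarrow> delta_bar L k f x = delta_bar L k h x"
  by (simp add: delta_bar_def d_cong[of x f h])

lemma (in local_finsler) pos_def_zero:
  assumes "x \<in> S" "(\<Sum>i\<in>UNIV. \<Sum>j\<in>UNIV. g i j x * w i * cnj (w j)) = 0"
  shows "w i = 0"
proof (rule ccontr)
  assume "w i \<noteq> 0"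
  then have "(\<chi> i. w i) \<noteq> 0" by (auto simp: vec_eq_iff)
  then have "0 < Re (\<Sum>i\<in>UNIV. \<Sum>j\<in>UNIV. g_matrix L x $ i $ j * (\<chi> i. w i) $ i * cnj ((\<chi> i. w i) $ j))"
    using pos_def[OF assms(1)] unfolding hermitian_pos_def_def by blast
  with assms(2) show False by (simp add: g_matrix_def)
qed

section \<open>Nonvanishing scalar curvature\<close>

locale finsler_scalar_curvature = local_finsler +
  fixes \<kappa> :: cfun
  assumes real_\<kappa>: "cnj (\<kappa> x) = \<kappa> x"
    and nonzero: "x \<in> S \<Longrightarrow> \<kappa> x \<noteq> 0"
    and curvature: "x \<in> S \<Longrightarrow> CF_curvature_lowered L r j h k x
      = \<kappa> x * (g j r x * g k h x + g k r x * g j h x)"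
begin

section \<open>Connection derivatives under the curvature condition\<close>

lemma curvature_upper:
  assumes "x \<in> S"
  shows "CF_curvature L i j h k x
    = \<kappa> x * ((if i = j then 1 else 0) * g k h x + (if i = k then 1 else 0) * g j h x)"
proof (rule g_cancel[OF assms, where X = "\<lambda>i. CF_curvature L i j h k x"
      and Y = "\<lambda>i. \<kappa> x * ((if i = j then 1 else 0) * g k h x + (if i = k then 1 else 0) * g j h x)"])
  fix r
  have "(\<Sum>i\<in>UNIV. g i r x * CF_curvature L i j h k x) = CF_curvature_lowered L r j h k x"
    by (simp add: CF_curvature_lowered_def)
  then show "(\<Sum>i\<in>UNIV. g i r x * CF_curvature L i j h k x) = (\<Sum>i\<in>UNIV. g i r x *
      (\<kappa> x * ((if i = j then 1 else 0) * g k h x + (if i = k then 1 else 0) * g j h x)))"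
    using exhaust_2[of j] exhaust_2[of k] curvature[OF assms]
    by (auto simp: sum_2 algebra_simps)
qed

lemma delta_bar_d_eta_N_curvature:
  assumes "x \<in> S"
  shows "delta_bar L h (d_eta j (N i k)) x
    = - \<kappa> x * ((if i = j then 1 else 0) * g k h x + (if i = k then 1 else 0) * g j h x)
      - (\<Sum>l\<in>UNIV. delta_bar L h (N l k) x * CF_C L i j l x)"
proof -
  have "delta_bar L h (CF_L L i j k) x = delta_bar L h (d_eta j (N i k)) x"
    by (rule delta_bar_cong[OF assms CF_L_eq])
  moreover have "X = - c * Y - Z" if "- X - Z = c * Y" for X Y Z c :: complex
    using that by algebra
  ultimately show ?thesis
    using curvature_upper[OF assms, of i j h k] by (simp only: CF_curvature_def)
qed

text \<open>Contract \<open>delta_bar_d_eta_N_curvature\<close> with \<eta>: \<open>N\<close> has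
  degree one, \<open>delta_bar\<close> annihilates the holomorphic fibre coordinates, and \<eta>
  annihilates \<open>CF_C\<close>.\<close>

lemma delta_bar_N:
  assumes "x \<in> S"
  shows "delta_bar L h (N i k) x
    = - \<kappa> x * (snd x $ i * g k h x + (if i = k then 1 else 0) * d_etabar h L x)"
proof -
  have "delta_bar L h (N i k) x = delta_bar L h (\<lambda>x. \<Sum>j\<in>UNIV. snd x $ j * d_eta j (N i k) x) x"
    by (rule delta_bar_cong[OF assms]) (simp add: eta_d_eta_N)
  also have "\<dots> = (\<Sum>j\<in>UNIV. snd x $ j * delta_bar L h (d_eta j (N i k)) x)"
    using assms by (simp add: delta_bar_def sum_2 algebra_simps)
  also have "\<dots> = - \<kappa> x * (snd x $ i * g k h x + (if i = k then 1 else 0) * (\<Sum>j\<in>UNIV. snd x $ j * g j h x))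
      - (\<Sum>l\<in>UNIV. delta_bar L h (N l k) x * (\<Sum>j\<in>UNIV. snd x $ j * CF_C L i l j x))"
    unfolding delta_bar_d_eta_N_curvature[OF assms] sum_2 CF_C_sym[OF assms, of i 2 1]
    using exhaust_2[of i] by (auto simp: algebra_simps)
  finally show ?thesis by (simp add: eta_g eta_CF_C assms)
qed

text \<open>When \<open>delta_bar_N\<close> is inserted into the sum with \<open>CF_C\<close>, its
  first term is killed by contraction with \<eta> and only the Kronecker term survives.\<close>

lemma delta_bar_d_eta_N:
  assumes "x \<in> S"
  shows "delta_bar L h (d_eta j (N i k)) x
    = - \<kappa> x * ((if i = j then 1 else 0) * g k h x + (if i = k then 1 else 0) * g j h x)
      + \<kappa> x * d_etabar h L x * CF_C L i j k x"
proof -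
  have "(\<Sum>l\<in>UNIV. delta_bar L h (N l k) x * CF_C L i j l x)
      = - \<kappa> x * (g k h x * (\<Sum>l\<in>UNIV. snd x $ l * CF_C L i j l x) + d_etabar h L x * CF_C L i j k x)"
    unfolding delta_bar_N[OF assms] sum_2 using exhaust_2[of k] by (auto simp: algebra_simps)
  then show ?thesis
    by (simp add: delta_bar_d_eta_N_curvature assms eta_CF_C)
qed

lemma g11_nonzero: "x \<in> S \<Longrightarrow> g 1 1 x \<noteq> 0"
  using pos_def_zero[of x "\<lambda>i. if i = 1 then 1 else 0" 1] by (auto simp: sum_2)

text \<open>Smoothness is recovered from the curvature: the component with all indices
  \<open>1\<close> equals \<open>2 * g 1 1\<close> times \<kappa>, and the diagonal entry
  \<open>g 1 1\<close> has no zeros.\<close>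

lemma smooth_\<kappa> [simp, intro]: "smooth_on S \<kappa>"
proof -
  let ?R = "\<lambda>x. - delta_bar L 1 (d_eta 1 (N 1 1)) x - (\<Sum>l\<in>UNIV. delta_bar L 1 (N l 1) x * CF_C L 1 1 l x)"
  have "smooth_on S ?R" by (simp add: sum_2)
  moreover have "smooth_on S (\<lambda>x. inverse (2 * g 1 1 x))"
    by (rule smooth_on_inverse[OF open_S]) (simp_all add: g11_nonzero)
  ultimately have "smooth_on S (\<lambda>x. ?R x * inverse (2 * g 1 1 x))"
    by (rule smooth_on_mult[OF open_S])
  moreover have "?R x * inverse (2 * g 1 1 x) = \<kappa> x" if "x \<in> S" for x
  proof -
    have "?R x = \<kappa> x * (2 * g 1 1 x)"
      by (simp add: delta_bar_d_eta_N_curvature[OF that, of 1 1 1 1])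
    then show ?thesis using g11_nonzero[OF that] by (simp only:) simp
  qed
  ultimately show ?thesis
    using smooth_on_cong[OF open_S, of "\<lambda>x. ?R x * inverse (2 * g 1 1 x)" \<kappa>] by simp
qed

text \<open>Contraction with the conjugate of \<eta> leaves only \<open>L\<close> and its first
  derivatives beside \<kappa>, ready for one more differentiation along the fibre.\<close>

lemma etabar_delta_bar_N:
  assumes "x \<in> S"
  shows "(\<Sum>h\<in>UNIV. cnj (snd x $ h) * delta_bar L h (N i k) x)
    = - \<kappa> x * (snd x $ i * d_eta k L x + (if i = k then 1 else 0) * L x)"
proof -
  have "(\<Sum>h\<in>UNIV. cnj (snd x $ h) * delta_bar L h (N i k) x)
    = - \<kappa> x * (snd x $ i * (\<Sum>h\<in>UNIV. cnj (snd x $ h) * g k h x)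
      + (if i = k then 1 else 0) * (\<Sum>h\<in>UNIV. cnj (snd x $ h) * d_etabar h L x))"
    unfolding delta_bar_N[OF assms] sum_2 by (simp add: algebra_simps)
  then show ?thesis by (simp add: etabar_g euler_bar assms)
qed

section \<open>Constancy of \<kappa> along the fibres\<close>

definition A :: "2 \<Rightarrow> 2 \<Rightarrow> cfun" where
  "A i l x = (\<Sum>k\<in>UNIV. snd x $ k * d_etabar l (N i k) x)"

text \<open>This is the fibre derivative of \<open>etabar_delta_bar_N\<close>: its left-hand side is known from
  \<open>delta_bar_d_eta_N\<close> up to the commutator of \<open>d_eta\<close> and \<open>delta_bar\<close>.\<close>

lemma compatibility:
  assumes "x \<in> S"
  shows "\<kappa> x * L x * CF_C L i j k x - (\<Sum>l\<in>UNIV. cnj (A l j x) * d_etabar l (N i k) x)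
    = - d_eta j \<kappa> x * (snd x $ i * d_eta k L x + (if i = k then 1 else 0) * L x)
      - \<kappa> x * snd x $ i * d_eta j (d_eta k L) x"
proof -
  \<comment> \<open>The commutator comes from \<open>d_eta j\<close> acting on the conjugate
    coefficients inside \<open>delta_bar\<close>; contracted with the conjugate of \<eta> these
    derivatives form the conjugate of \<open>A\<close>.\<close>
  have "(\<Sum>h\<in>UNIV. cnj (snd x $ h) * delta_bar L h (d_eta j (N i k)) x)
      - (\<Sum>l\<in>UNIV. cnj (A l j x) * d_etabar l (N i k) x)
    = d_eta j (\<lambda>x. \<Sum>h\<in>UNIV. cnj (snd x $ h) * (d_zbar h (N i k) x
        - (\<Sum>l\<in>UNIV. cnj (N l h x) * d_etabar l (N i k) x))) x"
    using assms by (simp add: delta_bar_def A_def sum_2 d_commute(3)[OF is_wirtinger_zbar]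
        d_commute(3)[OF is_wirtinger_etabar] algebra_simps)
  also have "\<dots> = d_eta j (\<lambda>x. - \<kappa> x * (snd x $ i * d_eta k L x + (if i = k then 1 else 0) * L x)) x"
    by (rule d_cong(3)[OF assms]) (simp add: etabar_delta_bar_N flip: delta_bar_def)
  also have "\<dots> = - d_eta j \<kappa> x * (snd x $ i * d_eta k L x + (if i = k then 1 else 0) * L x)
      - \<kappa> x * ((if i = j then 1 else 0) * d_eta k L x + snd x $ i * d_eta j (d_eta k L) x
        + (if i = k then 1 else 0) * d_eta j L x)"
    using assms by (simp add: algebra_simps)
  finally have *: "(\<Sum>h\<in>UNIV. cnj (snd x $ h) * delta_bar L h (d_eta j (N i k)) x)
      - (\<Sum>l\<in>UNIV. cnj (A l j x) * d_etabar l (N i k) x) = \<dots>" .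
  have "(\<Sum>h\<in>UNIV. cnj (snd x $ h) * delta_bar L h (d_eta j (N i k)) x)
    = - \<kappa> x * ((if i = j then 1 else 0) * (\<Sum>h\<in>UNIV. cnj (snd x $ h) * g k h x)
       + (if i = k then 1 else 0) * (\<Sum>h\<in>UNIV. cnj (snd x $ h) * g j h x))
      + \<kappa> x * (\<Sum>h\<in>UNIV. cnj (snd x $ h) * d_etabar h L x) * CF_C L i j k x"
    unfolding delta_bar_d_eta_N[OF assms] sum_2 by (simp add: algebra_simps)
  also have "\<dots> = - \<kappa> x * ((if i = j then 1 else 0) * d_eta k L x
       + (if i = k then 1 else 0) * d_eta j L x) + \<kappa> x * L x * CF_C L i j k x"
    by (simp only: etabar_g[OF assms] euler_bar[OF assms])
  finally have "(\<Sum>h\<in>UNIV. cnj (snd x $ h) * delta_bar L h (d_eta j (N i k)) x) = \<dots>" .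
  moreover have "c - Z = - p * Y - q * s * d"
    if "X - Z = - p * Y - q * (a + s * d + b)" "X = - q * (a + b) + c" for X Y Z a b c d p q s :: complex
    using that by algebra
  ultimately show ?thesis using * by blast
qed

text \<open>Contract \<open>compatibility\<close> with \<eta>. By homogeneity \<open>CF_C\<close>
  and the second derivatives of \<open>L\<close> drop out; the two remaining terms contribute
  equally, whence the factor two.\<close>

lemma compatibility_eta:
  assumes "x \<in> S"
  shows "(\<Sum>l\<in>UNIV. cnj (A l j x) * A i l x) = 2 * d_eta j \<kappa> x * snd x $ i * L x"
proof -
  have "\<kappa> x * L x * (\<Sum>k\<in>UNIV. snd x $ k * CF_C L i j k x) - (\<Sum>l\<in>UNIV. cnj (A l j x) * A i l x)
    = (\<Sum>k\<in>UNIV. snd x $ k * (\<kappa> x * L x * CF_C L i j k x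
        - (\<Sum>l\<in>UNIV. cnj (A l j x) * d_etabar l (N i k) x)))"
    by (simp add: A_def[of i] sum_2 algebra_simps)
  also have "\<dots> = - d_eta j \<kappa> x * (snd x $ i * (\<Sum>k\<in>UNIV. snd x $ k * d_eta k L x) + snd x $ i * L x)
      - \<kappa> x * snd x $ i * (\<Sum>k\<in>UNIV. snd x $ k * d_eta j (d_eta k L) x)"
    unfolding compatibility[OF assms] unfolding sum_2 using exhaust_2[of i] by (auto simp: algebra_simps)
  finally show ?thesis
    by (simp add: eta_CF_C[OF assms] euler[OF assms] eta_d_eta_eta_L[OF assms])
qed

lemma g_A:
  assumes "x \<in> S"
  shows "(\<Sum>i\<in>UNIV. g i r x * A i l x) = (\<Sum>k\<in>UNIV. snd x $ k * d_z k (d_etabar l (d_etabar r L)) x)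
      - (\<Sum>i\<in>UNIV. d_etabar l (g i r) x * (\<Sum>k\<in>UNIV. snd x $ k * N i k x))"
proof -
  have "(\<Sum>i\<in>UNIV. g i r x * A i l x) = (\<Sum>k\<in>UNIV. snd x $ k * (\<Sum>i\<in>UNIV. g i r x * d_etabar l (N i k) x))"
    by (simp add: A_def sum_2 algebra_simps)
  then show ?thesis by (simp add: g_d_etabar_N[OF assms]) (simp add: sum_2 algebra_simps)
qed

text \<open>The right-hand side of \<open>g_A\<close> is symmetric in \<open>l\<close> and
  \<open>r\<close>, because conjugate fibre derivatives commute.\<close>

lemma g_A_sym:
  assumes "x \<in> S"
  shows "(\<Sum>i\<in>UNIV. g i r x * A i l x) = (\<Sum>i\<in>UNIV. g i l x * A i r x)"
proof -
  have "d_z k (d_etabar l (d_etabar r L)) x = d_z k (d_etabar r (d_etabar l L)) x" for k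
    by (rule d_cong(1)[OF assms d_commute(4)[OF is_wirtinger_etabar smooth_L]])
  then show ?thesis by (simp add: g_A[OF assms] d_etabar_g_sym[OF assms, of l _ r])
qed

lemma etabar_A:
  assumes "x \<in> S"
  shows "(\<Sum>l\<in>UNIV. cnj (snd x $ l) * A i l x) = 0"
proof -
  have "(\<Sum>l\<in>UNIV. cnj (snd x $ l) * A i l x)
     = (\<Sum>k\<in>UNIV. snd x $ k * (\<Sum>l\<in>UNIV. cnj (snd x $ l) * d_etabar l (N i k) x))"
    by (simp add: A_def sum_2 algebra_simps)
  then show ?thesis by (simp add: etabar_d_etabar_N[OF assms])
qed

text \<open>The gradient of \<open>L\<close> is \<open>g\<close> contracted with the conjugate of
  \<eta>; symmetry moves this contraction onto the lower index of \<open>A\<close>, where it gives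
  zero.\<close>

lemma d_eta_L_A:
  assumes "x \<in> S"
  shows "(\<Sum>i\<in>UNIV. d_eta i L x * A i l x) = 0"
proof -
  have "(\<Sum>i\<in>UNIV. d_eta i L x * A i l x)
      = (\<Sum>r\<in>UNIV. cnj (snd x $ r) * (\<Sum>i\<in>UNIV. g i r x * A i l x))"
    by (simp add: sum_2 algebra_simps flip: etabar_g[OF assms])
  also have "\<dots> = (\<Sum>i\<in>UNIV. g i l x * (\<Sum>r\<in>UNIV. cnj (snd x $ r) * A i r x))"
    unfolding g_A_sym[OF assms, of _ l] by (simp add: sum_2 algebra_simps)
  finally show ?thesis by (simp add: etabar_A[OF assms])
qed

text \<open>Pair \<open>compatibility_eta\<close> with the gradient of \<open>L\<close>: the left
  side vanishes by \<open>d_eta_L_A\<close>, and the right side is \<open>2 * L x * L x\<close>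
  times the derivative of \<kappa>.\<close>

lemma d_eta_\<kappa>:
  assumes "x \<in> S"
  shows "d_eta j \<kappa> x = 0"
proof -
  have "(\<Sum>i\<in>UNIV. d_eta i L x * (\<Sum>l\<in>UNIV. cnj (A l j x) * A i l x))
      = (\<Sum>l\<in>UNIV. cnj (A l j x) * (\<Sum>i\<in>UNIV. d_eta i L x * A i l x))"
    by (simp add: sum_2 algebra_simps)
  moreover have "(\<Sum>i\<in>UNIV. d_eta i L x * (\<Sum>l\<in>UNIV. cnj (A l j x) * A i l x))
      = 2 * d_eta j \<kappa> x * L x * (\<Sum>i\<in>UNIV. snd x $ i * d_eta i L x)"
    unfolding compatibility_eta[OF assms] by (simp add: sum_2 algebra_simps)
  ultimately show ?thesis
    using L_nonzero[OF assms] by (simp add: d_eta_L_A[OF assms] euler[OF assms])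
qed

text \<open>With \<open>d_eta j \<kappa> = 0\<close> the product of \<open>A\<close> and its conjugate vanishes; since \<open>g A\<close> is symmetric,
  the diagonal entries of this product are values of the definite form \<open>g\<close>.\<close>

lemma A_zero:
  assumes "x \<in> S"
  shows "A i l x = 0"
proof (rule pos_def_zero[OF assms, where w = "\<lambda>i. A i l x"])
  have "(\<Sum>i\<in>UNIV. \<Sum>j\<in>UNIV. g i j x * A i l x * cnj (A j l x))
      = (\<Sum>j\<in>UNIV. cnj (A j l x) * (\<Sum>i\<in>UNIV. g i j x * A i l x))"
    by (simp add: sum_2 algebra_simps)
  also have "\<dots> = (\<Sum>i\<in>UNIV. g i l x * (\<Sum>j\<in>UNIV. cnj (A j l x) * A i j x))"
    unfolding g_A_sym[OF assms, of _ l] by (simp add: sum_2 algebra_simps)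
  finally show "(\<Sum>i\<in>UNIV. \<Sum>j\<in>UNIV. g i j x * A i l x * cnj (A j l x)) = 0"
    by (simp add: compatibility_eta[OF assms] d_eta_\<kappa>[OF assms])
qed

text \<open>With \<open>A\<close> and the fibre derivatives of \<kappa> gone, division by \<kappa>
  in \<open>compatibility\<close> makes \<open>L\<close> times \<open>CF_C\<close> equal to minus
  \<eta> times the pure second derivative. Pairing with the gradient of \<open>L\<close> equates
  \<open>L\<close> times that derivative with its own negative.\<close>

lemma d_eta_d_eta_L:
  assumes "x \<in> S"
  shows "d_eta j (d_eta k L) x = 0"
proof -
  have *: "L x * CF_C L i j k x = - (snd x $ i * d_eta j (d_eta k L) x)" for i
  proof -
    have "\<kappa> x * (L x * CF_C L i j k x + snd x $ i * d_eta j (d_eta k L) x) = 0"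
      using compatibility[OF assms, of i j k]
      by (simp add: A_zero[OF assms] d_eta_\<kappa>[OF assms] algebra_simps)
    then show ?thesis using nonzero[OF assms] by (simp add: eq_neg_iff_add_eq_0)
  qed
  have "L x * (\<Sum>r\<in>UNIV. cnj (snd x $ r) * (\<Sum>i\<in>UNIV. g i r x * CF_C L i j k x))
      = (\<Sum>i\<in>UNIV. (\<Sum>r\<in>UNIV. cnj (snd x $ r) * g i r x) * (L x * CF_C L i j k x))"
    by (simp add: sum_2 algebra_simps)
  also have "\<dots> = - ((\<Sum>i\<in>UNIV. snd x $ i * d_eta i L x) * d_eta j (d_eta k L) x)"
    unfolding * by (simp add: etabar_g[OF assms]) (simp add: sum_2 algebra_simps)
  also have "\<dots> = - (L x * d_eta j (d_eta k L) x)" by (simp add: euler[OF assms])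
  finally have "L x * d_eta k (d_eta j L) x = - (L x * d_eta j (d_eta k L) x)"
    by (simp add: g_CF_C[OF assms] etabar_d_eta_g[OF assms])
  moreover have "d_eta k (d_eta j L) x = d_eta j (d_eta k L) x"
    using assms by (intro d_commute(3) is_wirtinger_eta) auto
  ultimately show ?thesis using L_nonzero[OF assms] by simp
qed

section \<open>Independence of metric and connection from the fibre coordinates\<close>

lemma d_eta_g:
  assumes "x \<in> S"
  shows "d_eta k (g j r) x = 0"
proof -
  have "d_etabar r (d_eta k (d_eta j L)) x = d_etabar r (\<lambda>x. 0) x"
    by (rule d_cong(4)[OF assms d_eta_d_eta_L])
  moreover have "d_etabar r (d_eta k (d_eta j L)) x = d_eta k (d_etabar r (d_eta j L)) x"
    using assms by (intro d_commute(4) is_wirtinger_eta) auto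
  moreover have "d_eta k (d_etabar r (d_eta j L)) x = d_eta k (g j r) x"
    by (rule d_cong(3)[OF assms d_etabar_L_eta])
  ultimately show ?thesis using assms by simp
qed

lemma d_etabar_g:
  assumes "x \<in> S"
  shows "d_etabar k (g j r) x = 0"
proof -
  have "d_etabar k (g j r) x = d_etabar k (\<lambda>x. cnj (g r j x)) x"
    by (rule d_cong(4)[OF assms]) (simp add: g_cnj)
  then show ?thesis using assms by (simp add: d_eta_g)
qed

text \<open>So the metric is Hermitian, and \<open>d_eta j (N i k)\<close> is its Chern connection.\<close>

lemma g_connection:
  assumes "x \<in> S"
  shows "(\<Sum>i\<in>UNIV. g i r x * d_eta j (N i k) x) = d_z k (g j r) x"
  by (simp add: g_d_eta_N assms delta_def d_eta_g)

text \<open>Neither \<open>g\<close> nor its \<open>z\<close> derivatives vary along the fibre, so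
  differentiating \<open>g_connection\<close> leaves only \<open>g\<close> contracted with the
  unknown.\<close>

lemma d_eta_connection:
  assumes "x \<in> S"
  shows "d_eta m (d_eta j (N i k)) x = 0"
proof (rule g_cancel_zero[OF assms, where X = "\<lambda>i. d_eta m (d_eta j (N i k)) x"])
  fix r
  have "d_eta m (d_z k (g j r)) x = d_z k (d_eta m (g j r)) x"
    using assms by (intro d_commute(3) is_wirtinger_z) auto
  also have "\<dots> = d_z k (\<lambda>x. 0) x" by (rule d_cong(1)[OF assms d_eta_g])
  also have "\<dots> = 0" using assms by simp
  also have "d_eta m (d_z k (g j r)) x = d_eta m (\<lambda>x. \<Sum>i\<in>UNIV. g i r x * d_eta j (N i k) x) x"
    by (rule d_cong(3)[OF assms g_connection[symmetric]])
  finally have "d_eta m (\<lambda>x. \<Sum>i\<in>UNIV. g i r x * d_eta j (N i k) x) x = 0" .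
  then show "(\<Sum>i\<in>UNIV. g i r x * d_eta m (d_eta j (N i k)) x) = 0"
    using assms by (simp add: sum_2 d_eta_g)
qed

lemma d_etabar_connection:
  assumes "x \<in> S"
  shows "d_etabar m (d_eta j (N i k)) x = 0"
proof (rule g_cancel_zero[OF assms, where X = "\<lambda>i. d_etabar m (d_eta j (N i k)) x"])
  fix r
  have "d_etabar m (d_z k (g j r)) x = d_z k (d_etabar m (g j r)) x"
    using assms by (intro d_commute(4) is_wirtinger_z) auto
  also have "\<dots> = d_z k (\<lambda>x. 0) x" by (rule d_cong(1)[OF assms d_etabar_g])
  also have "\<dots> = 0" using assms by simp
  also have "d_etabar m (d_z k (g j r)) x = d_etabar m (\<lambda>x. \<Sum>i\<in>UNIV. g i r x * d_eta j (N i k) x) x"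
    by (rule d_cong(4)[OF assms g_connection[symmetric]])
  finally have "d_etabar m (\<lambda>x. \<Sum>i\<in>UNIV. g i r x * d_eta j (N i k) x) x = 0" .
  then show "(\<Sum>i\<in>UNIV. g i r x * d_etabar m (d_eta j (N i k)) x) = 0"
    using assms by (simp add: sum_2 d_etabar_g)
qed

section \<open>Trace of the Chern connection and closedness of the form of \<kappa> times
  \<open>g\<close>\<close>

definition \<theta> :: "2 \<Rightarrow> cfun" where
  "\<theta> k x = (\<Sum>i\<in>UNIV. d_eta i (N i k) x)"

lemma smooth_\<theta> [simp, intro]: "smooth_on S (\<theta> k)"
proof -
  have "\<theta> k = (\<lambda>x. d_eta 1 (N 1 k) x + d_eta 2 (N 2 k) x)"
    by (simp add: \<theta>_def sum_2 fun_eq_iff)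
  then show ?thesis by simp
qed

text \<open>With \<open>CF_C\<close> zero and the connection constant along fibres,
  \<open>delta_bar\<close> reduces to \<open>d_zbar\<close>. The trace of the identity contributes
  two and the other term one, hence the factor three.\<close>

lemma d_zbar_\<theta>:
  assumes "x \<in> S"
  shows "d_zbar h (\<theta> k) x = - 3 * (\<kappa> x * g k h x)"
proof -
  have "CF_C L i j k x = 0" for i j k
    by (simp add: CF_C_def d_eta_g assms)
  then have *: "d_zbar h (d_eta j (N i k)) x
    = - \<kappa> x * ((if i = j then 1 else 0) * g k h x + (if i = k then 1 else 0) * g j h x)" for i j
    using delta_bar_d_eta_N[OF assms, of h j i k]
    by (simp add: delta_bar_def d_etabar_connection[OF assms])
  have "d_zbar h (\<theta> k) x = d_zbar h (\<lambda>x. d_eta 1 (N 1 k) x + d_eta 2 (N 2 k) x) x"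
    by (rule d_cong(2)[OF assms]) (simp add: \<theta>_def sum_2)
  also have "\<dots> = d_zbar h (d_eta 1 (N 1 k)) x + d_zbar h (d_eta 2 (N 2 k)) x"
    using assms by simp
  also have "\<dots> = - 3 * (\<kappa> x * g k h x)"
    unfolding * using exhaust_2[of k] by (auto simp: algebra_simps)
  finally show ?thesis .
qed

text \<open>Jacobi's formula: \<theta> is the logarithmic derivative of \<open>detg\<close>, written
  without a logarithm.\<close>

lemma detg_\<theta>:
  assumes "x \<in> S"
  shows "detg x * \<theta> k x = d_z k (\<lambda>x. detg x) x"
proof -
  note c = g_connection[OF assms, unfolded sum_2, symmetric]
  have "d_z k (\<lambda>x. detg x) x = d_z k (g 1 1) x * g 2 2 x + g 1 1 x * d_z k (g 2 2) x
     - (d_z k (g 1 2) x * g 2 1 x + g 1 2 x * d_z k (g 2 1) x)"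
    using assms by simp
  then show ?thesis unfolding c \<theta>_def sum_2 by (simp add: algebra_simps)
qed

text \<open>Mixed second derivatives of the logarithm of \<open>detg\<close> commute; clearing
  denominators avoids choosing a branch.\<close>

lemma d_z_\<theta>_sym:
  assumes "x \<in> S"
  shows "d_z l (\<theta> k) x = d_z k (\<theta> l) x"
proof -
  have e: "d_z l (\<lambda>x. detg x) x * \<theta> k x + detg x * d_z l (\<theta> k) x = d_z l (d_z k (\<lambda>x. detg x)) x" for l k
  proof -
    have "d_z l (\<lambda>x. detg x * \<theta> k x) x = d_z l (d_z k (\<lambda>x. detg x)) x"
      by (rule d_cong(1)[OF assms detg_\<theta>])
    moreover have "d_z l (\<lambda>x. detg x * \<theta> k x) x = d_z l (\<lambda>x. detg x) x * \<theta> k x + detg x * d_z l (\<theta> k) x"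
      using assms by (intro is_wirtinger_z[THEN wirtinger_mult, OF open_S]) auto
    ultimately show ?thesis by simp
  qed
  \<comment> \<open>The second factor \<open>detg\<close> makes the product of first derivatives
    symmetric in \<open>k\<close> and \<open>l\<close>.\<close>
  have expand: "detg x * (detg x * d_z l (\<theta> k) x) + (detg x * \<theta> l x) * (detg x * \<theta> k x)
      = detg x * d_z l (d_z k (\<lambda>x. detg x)) x" for l k
    unfolding e[symmetric] detg_\<theta>[OF assms, symmetric] by (simp add: algebra_simps)
  have "d_z l (d_z k (\<lambda>x. detg x)) x = d_z k (d_z l (\<lambda>x. detg x)) x"
    using assms by (intro d_commute(1) is_wirtinger_z) auto
  then have "detg x * (detg x * d_z l (\<theta> k) x) + (detg x * \<theta> l x) * (detg x * \<theta> k x)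
      = detg x * (detg x * d_z k (\<theta> l) x) + (detg x * \<theta> k x) * (detg x * \<theta> l x)"
    by (simp only: expand)
  then have "detg x * (detg x * d_z l (\<theta> k) x) = detg x * (detg x * d_z k (\<theta> l) x)"
    by (simp only: mult.commute[of "detg x * \<theta> k x"] add_right_cancel)
  then show ?thesis using detg_nonzero[OF assms] by (simp only: mult_cancel_left) simp
qed

text \<open>By \<open>d_zbar_\<theta>\<close>, each side times \<open>- 3\<close> is a
  \<open>d_zbar\<close> derivative of an expression that \<open>d_z_\<theta>_sym\<close> shows to be
  symmetric.\<close>

lemma d_z_\<kappa>_g_sym:
  assumes "x \<in> S"
  shows "d_z l \<kappa> x * g k h x + \<kappa> x * d_z l (g k h) x = d_z k \<kappa> x * g l h x + \<kappa> x * d_z k (g l h) x"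
proof -
  have "- 3 * (d_z l \<kappa> x * g k h x + \<kappa> x * d_z l (g k h) x) = d_zbar h (d_z l (\<theta> k)) x" for l k
  proof -
    have "d_zbar h (d_z l (\<theta> k)) x = d_z l (d_zbar h (\<theta> k)) x"
      using assms by (intro d_commute(2) is_wirtinger_z) auto
    also have "\<dots> = d_z l (\<lambda>x. - 3 * (\<kappa> x * g k h x)) x"
      by (rule d_cong(1)[OF assms d_zbar_\<theta>])
    finally show ?thesis using assms by simp
  qed
  moreover have "d_zbar h (d_z l (\<theta> k)) x = d_zbar h (d_z k (\<theta> l)) x"
    by (rule d_cong(2)[OF assms d_z_\<theta>_sym])
  ultimately have "- 3 * (d_z l \<kappa> x * g k h x + \<kappa> x * d_z l (g k h) x)
      = - 3 * (d_z k \<kappa> x * g l h x + \<kappa> x * d_z k (g l h) x)" by metis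
  then show ?thesis by (simp only: mult_cancel_left) simp
qed

section \<open>Torsion and the gradient of \<kappa>\<close>

lemma torsion_eq: "x \<in> S \<Longrightarrow> CF_torsion L i j k x = d_eta j (N i k) x - d_eta k (N i j) x"
  by (simp add: CF_torsion_def CF_L_eq)

text \<open>The lowered torsion is the antisymmetrised derivative of \<open>g\<close>;
  \<open>d_z_\<kappa>_g_sym\<close> trades it for derivatives of \<kappa>.\<close>

lemma torsion_gradient:
  assumes "x \<in> S"
  shows "\<kappa> x * (\<Sum>i\<in>UNIV. g i h x * CF_torsion L i j k x) = d_z j \<kappa> x * g k h x - d_z k \<kappa> x * g j h x"
proof -
  have "(\<Sum>i\<in>UNIV. g i h x * CF_torsion L i j k x) = d_z k (g j h) x - d_z j (g k h) x"
    unfolding torsion_eq[OF assms] g_connection[OF assms, symmetric] by (simp add: sum_2 algebra_simps)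
  moreover have "q * t = u - v" if "t = b - a" "u + q * a = v + q * b" for q t u v a b :: complex
    using that by algebra
  ultimately show ?thesis using d_z_\<kappa>_g_sym[OF assms, of j k h] by blast
qed

lemma torsion_zero_if_constant:
  assumes "x \<in> S" "\<And>k. d_z k \<kappa> x = 0"
  shows "CF_torsion L i j k x = 0"
proof (rule g_cancel_zero[OF assms(1), where X = "\<lambda>i. CF_torsion L i j k x"])
  fix r
  show "(\<Sum>i\<in>UNIV. g i r x * CF_torsion L i j k x) = 0"
    using torsion_gradient[OF assms(1), of r j k] nonzero[OF assms(1)] by (simp add: assms(2))
qed

text \<open>The torsion is constant along the fibres, so differentiating the contracted condition in
  \<eta> gives the vanishing of the torsion itself, and \<open>torsion_gradient\<close> becomes a
  condition on \<kappa> alone.\<close>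

lemma d_z_\<kappa>_zero_if_kaehler:
  assumes "\<And>x i k. x \<in> S \<Longrightarrow> (\<Sum>j\<in>UNIV. CF_torsion L i j k x * snd x $ j) = 0" "x \<in> S"
  shows "d_z k \<kappa> x = 0"
proof -
  have T: "CF_torsion L i m k x = 0" for i m k
  proof -
    have "d_eta m (\<lambda>x. \<Sum>j\<in>UNIV. (d_eta j (N i k) x - d_eta k (N i j) x) * snd x $ j) x = d_eta m (\<lambda>x. 0) x"
      by (rule d_cong(3)[OF assms(2)]) (simp add: assms(1) flip: torsion_eq)
    then show ?thesis
      using assms(2) exhaust_2[of m] by (auto simp: sum_2 d_eta_connection torsion_eq)
  qed
  have *: "d_z j \<kappa> x * g k h x = d_z k \<kappa> x * g j h x" for j k h
    using torsion_gradient[OF assms(2), of h j k] by (simp add: T)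
  \<comment> \<open>The two values of \<open>h\<close> give a homogeneous linear system for the two
    derivatives, with determinant \<open>detg\<close>.\<close>
  have "d_z 1 \<kappa> x * detg x = 0" "d_z 2 \<kappa> x * detg x = 0"
    using *[of 1 2 1] *[of 1 2 2] by algebra+
  then show ?thesis using detg_nonzero[OF assms(2)] exhaust_2[of k] by auto
qed

end

section \<open>Charts and the tangent bundle\<close>

locale complex_surface =
  fixes A :: "('a::{t2_space, second_countable_topology}) chart set"
  assumes atlas: "complex_atlas2 A"
begin

lemma chart:
  assumes "c \<in> A"
  shows "open (fst c)" "open (snd c ` fst c)" "inj_on (snd c) (fst c)" "continuous_on (fst c) (snd c)"
proof -
  obtain \<psi> where \<psi>: "homeomorphism (fst c) (snd c ` fst c) (snd c) \<psi>"
    and op: "open (fst c)" "open (snd c ` fst c)"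
    using atlas assms unfolding complex_atlas2_def is_chart_def by blast
  show "open (fst c)" "open (snd c ` fst c)" by (fact op)+
  show "inj_on (snd c) (fst c)"
    using homeomorphism_apply1[OF \<psi>] by (rule inj_on_inverseI)
  show "continuous_on (fst c) (snd c)" by (rule homeomorphism_cont1[OF \<psi>])
qed

lemma chart_around:
  obtains c where "c \<in> A" "p \<in> fst c"
  using atlas unfolding complex_atlas2_def by blast

lemma open_chart_image:
  assumes "c \<in> A" "open W" "W \<subseteq> fst c"
  shows "open (snd c ` W)"
proof -
  obtain \<psi> where "homeomorphism (fst c) (snd c ` fst c) (snd c) \<psi>"
    using atlas assms(1) unfolding complex_atlas2_def is_chart_def by auto
  then have "openin (top_of_set (snd c ` fst c)) (snd c ` W)"
    by (rule homeomorphism_imp_open_map) (simp add: open_subset assms(2,3))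
  then show ?thesis using chart(2)[OF assms(1)] by (simp add: openin_open_eq)
qed

lemma chart_inv_chart [simp]: "c \<in> A \<Longrightarrow> p \<in> fst c \<Longrightarrow> chart_inv c (snd c p) = p"
  by (simp add: chart_inv_def chart(3))

lemma transition_chart [simp]: "c \<in> A \<Longrightarrow> p \<in> fst c \<Longrightarrow> transition c d (snd c p) = snd d p"
  by (simp add: transition_def)

section \<open>Jacobians of coordinate changes and components of tangent vectors\<close>

definition J :: "'a chart \<Rightarrow> 'a chart \<Rightarrow> 'a \<Rightarrow> complex^2 \<Rightarrow> complex^2" where
  "J c d p = frechet_derivative (transition c d) (at (snd c p))"

lemma
  assumes "c \<in> A" "d \<in> A" "p \<in> fst c" "p \<in> fst d"
  shows has_derivative_transition: "(transition c d has_derivative J c d p) (at (snd c p))"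
    and J_scale: "J c d p (\<mu> *s \<eta>) = \<mu> *s J c d p \<eta>"
proof -
  obtain D where D: "(transition c d has_derivative D) (at (snd c p))" "\<And>c v. D (c *s v) = c *s D v"
    using atlas assms unfolding complex_atlas2_def holomorphic2_on_def by blast
  moreover have "D = J c d p" unfolding J_def by (rule frechet_derivative_at[OF D(1)])
  ultimately show "(transition c d has_derivative J c d p) (at (snd c p))"
    "J c d p (\<mu> *s \<eta>) = \<mu> *s J c d p \<eta>" by simp_all
qed

lemma J_zero:
  assumes "c \<in> A" "d \<in> A" "p \<in> fst c" "p \<in> fst d"
  shows "J c d p 0 = 0"
  using J_scale[OF assms, of 0 0] by simp

text \<open>The chain rule gives the cocycle condition.\<close>

lemma J_compose:
  assumes "c \<in> A" "d \<in> A" "e \<in> A" "p \<in> fst c" "p \<in> fst d" "p \<in> fst e"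
  shows "J d e p (J c d p \<eta>) = J c e p \<eta>"
proof -
  have "(transition d e has_derivative J d e p) (at (transition c d (snd c p)))"
    using has_derivative_transition[of d e p] assms by simp
  from diff_chain_at[OF has_derivative_transition[of c d p] this] assms
  have "(transition d e \<circ> transition c d has_derivative J d e p \<circ> J c d p) (at (snd c p))"
    by simp
  \<comment> \<open>The composite is compared with the direct transition on the image of the overlap
    of \<open>c\<close> and \<open>d\<close>, an open neighbourhood of the point.\<close>
  then have "(transition c e has_derivative J d e p \<circ> J c d p) (at (snd c p))"
  proof (rule has_derivative_transform_within_open)
    show "open (snd c ` (fst c \<inter> fst d))"
      by (rule open_chart_image) (auto simp: assms chart)
  qed (use assms in auto)
  with has_derivative_transition[of c e p] assms show ?thesis
    using has_derivative_unique by (metis comp_apply)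
qed

lemma J_same:
  assumes "c \<in> A" "p \<in> fst c"
  shows "J c c p \<eta> = \<eta>"
proof -
  have "((\<lambda>z. z) has_derivative (\<lambda>\<eta>. \<eta>)) (at (snd c p))" by simp
  then have "(transition c c has_derivative (\<lambda>\<eta>. \<eta>)) (at (snd c p))"
    by (rule has_derivative_transform_within_open[of _ _ _ _ "snd c ` fst c"])
      (use assms chart in auto)
  with has_derivative_transition[of c c p] assms show ?thesis
    using has_derivative_unique by metis
qed

lemma tvec_of_J: "tvec_of A c p \<eta> = (\<lambda>d. if d \<in> A \<and> p \<in> fst d then J c d p \<eta> else 0)"
  by (simp add: tvec_of_def J_def fun_eq_iff)

lemma tvec_of_self: "c \<in> A \<Longrightarrow> p \<in> fst c \<Longrightarrow> tvec_of A c p \<eta> c = \<eta>"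
  by (simp add: tvec_of_J J_same)

lemma tvec_of_tangent: "c \<in> A \<Longrightarrow> p \<in> fst c \<Longrightarrow> (p, tvec_of A c p \<eta>) \<in> tangent_bundle A"
  by (auto simp: tangent_bundle_def tvec_of_J J_compose simp flip: J_def)

lemma tvec_of_slit:
  "c \<in> A \<Longrightarrow> p \<in> fst c \<Longrightarrow> \<eta> \<noteq> 0 \<Longrightarrow> (p, tvec_of A c p \<eta>) \<in> slit_tangent_bundle A"
  using tvec_of_self[of c p \<eta>] by (auto simp: slit_tangent_bundle_def tvec_of_tangent)

text \<open>The transformation law determines the whole family from its components in one chart, and
  the linear Jacobians would carry zero components to zero everywhere.\<close>

lemma slit_tangentE:
  assumes "(p, v) \<in> slit_tangent_bundle A" "c \<in> A" "p \<in> fst c"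
  shows "v = tvec_of A c p (v c)" "v c \<noteq> 0"
proof -
  show v: "v = tvec_of A c p (v c)"
  proof
    fix d
    have "(p, v) \<in> tangent_bundle A" using assms(1) by (simp add: slit_tangent_bundle_def)
    then have "d \<in> A \<and> p \<in> fst d \<longrightarrow> v d = J c d p (v c)" "\<not> (d \<in> A \<and> p \<in> fst d) \<longrightarrow> v d = 0"
      using assms(2,3) unfolding tangent_bundle_def J_def by blast+
    then show "v d = tvec_of A c p (v c) d" by (simp only: tvec_of_J split: if_split)
  qed
  show "v c \<noteq> 0"
  proof
    assume "v c = 0"
    then have "tvec_of A c p (v c) = (\<lambda>_. 0)" by (auto simp: tvec_of_J J_zero assms(2,3))
    with v have "v = (\<lambda>_. 0)" by simp
    with assms(1) show False by (simp add: slit_tangent_bundle_def)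
  qed
qed

lemma tvec_of_scale:
  "c \<in> A \<Longrightarrow> p \<in> fst c \<Longrightarrow> tvec_of A c p (\<mu> *s \<eta>) = (\<lambda>d. \<mu> *s tvec_of A c p \<eta> d)"
  by (auto simp: tvec_of_J J_scale)

lemma open_slit_coords: "c \<in> A \<Longrightarrow> open (slit_coords c)"
  unfolding slit_coords_def by (intro open_Times chart) auto

lemma slit_coords_mem:
  "c \<in> A \<Longrightarrow> (z, \<eta>) \<in> slit_coords c \<Longrightarrow> (chart_inv c z, tvec_of A c (chart_inv c z) \<eta>) \<in> slit_tangent_bundle A"
  by (auto simp: slit_coords_def intro: tvec_of_slit)

end

section \<open>Homogeneity in infinitesimal form\<close>

lemma frechet_derivative_fibre_direction:
  fixes f :: "(complex^2) \<times> (complex^2) \<Rightarrow> real"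
  assumes "f differentiable at x"
  shows "frechet_derivative f (at x) (0, \<xi>)
    = (\<Sum>k\<in>UNIV. Re (\<xi> $ k) * frechet_derivative f (at x) (0, axis k 1)
        + Im (\<xi> $ k) * frechet_derivative f (at x) (0, axis k \<i>))"
proof -
  note lin = linear_frechet_derivative[OF assms]
  have "\<xi> = (\<Sum>k\<in>UNIV. Re (\<xi> $ k) *\<^sub>R axis k 1 + Im (\<xi> $ k) *\<^sub>R axis k \<i>)"
    by (simp add: vec_eq_iff sum_2 axis_def complex_eq_iff forall_2)
  then have split: "(0, \<xi>) = (\<Sum>k\<in>UNIV. Re (\<xi> $ k) *\<^sub>R (0::complex^2, axis k 1) + Im (\<xi> $ k) *\<^sub>R (0, axis k \<i>))"
    by (simp add: sum_2)
  show ?thesis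
    by (subst split) (simp only: linear_sum[OF lin] linear_add[OF lin] linear_scale[OF lin] real_scaleR_def)
qed

text \<open>The real part of the Euler identity is the derivative along \<open>\<eta>\<close>, the imaginary part the
  derivative along \<open>\<i> *s \<eta>\<close>.\<close>

lemma euler_fibre:
  fixes f :: "(complex^2) \<times> (complex^2) \<Rightarrow> real"
  assumes diff: "f differentiable at (z, \<eta>)"
    and hom: "\<And>\<mu>. f (z, \<mu> *s \<eta>) = (cmod \<mu>)\<^sup>2 * f (z, \<eta>)"
  shows "(\<Sum>k\<in>UNIV. \<eta> $ k * d_eta k (\<lambda>x. complex_of_real (f x)) (z, \<eta>)) = complex_of_real (f (z, \<eta>))"
proof -
  let ?D = "frechet_derivative f (at (z, \<eta>))"
  have D: "?D (0, w *s \<eta>) = 2 * Re w * f (z, \<eta>)" for w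
  proof (rule DERIV_unique)
    show "((\<lambda>s. f ((z, \<eta>) + s *\<^sub>R (0, w *s \<eta>))) has_real_derivative ?D (0, w *s \<eta>)) (at 0)"
      using DERIV_along_line[of f "(z, \<eta>)" 0 "(0, w *s \<eta>)"] diff by simp
    have "f ((z, \<eta>) + s *\<^sub>R (0, w *s \<eta>)) = ((1 + s * Re w)\<^sup>2 + (s * Im w)\<^sup>2) * f (z, \<eta>)" for s
    proof -
      have "(z, \<eta>) + s *\<^sub>R (0, w *s \<eta>) = (z, (1 + complex_of_real s * w) *s \<eta>)"
        by (simp add: vec_eq_iff complex_eq_iff algebra_simps)
      then show ?thesis using hom[of "1 + complex_of_real s * w"] by (simp add: cmod_power2)
    qed
    moreover have "((\<lambda>s. ((1 + s * Re w)\<^sup>2 + (s * Im w)\<^sup>2) * f (z, \<eta>)) has_real_derivative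
        2 * Re w * f (z, \<eta>)) (at 0)"
      by (auto intro!: derivative_eq_intros)
    ultimately show "((\<lambda>s. f ((z, \<eta>) + s *\<^sub>R (0, w *s \<eta>))) has_real_derivative 2 * Re w * f (z, \<eta>)) (at 0)"
      by simp
  qed
  have "(\<Sum>k\<in>UNIV. Re (\<eta> $ k) * ?D (0, axis k 1) + Im (\<eta> $ k) * ?D (0, axis k \<i>)) = 2 * f (z, \<eta>)"
    using D[of 1] frechet_derivative_fibre_direction[OF diff, of \<eta>] by simp
  moreover have "(\<Sum>k\<in>UNIV. - Im (\<eta> $ k) * ?D (0, axis k 1) + Re (\<eta> $ k) * ?D (0, axis k \<i>)) = 0"
    using D[of \<i>] frechet_derivative_fibre_direction[OF diff, of "\<i> *s \<eta>"] by simp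
  moreover have eta: "d_eta k (\<lambda>x. complex_of_real (f x)) (z, \<eta>)
    = (complex_of_real (?D (0, axis k 1)) - \<i> * complex_of_real (?D (0, axis k \<i>))) / 2" for k
    by (simp add: d_eta_def frechet_derivative_bounded_linear_compose[OF diff bounded_linear_of_real])
  ultimately show ?thesis
    unfolding eta by (simp add: sum_2 complex_eq_iff field_simps)
qed

section \<open>Globalisation\<close>

context
  fixes A :: "('a::{t2_space, second_countable_topology}) chart set"
    and F K :: "'a \<times> 'a tvec \<Rightarrow> real"
  assumes atlas: "complex_atlas2 A"
    and finsler: "complex_finsler A F"
    and curvature: "\<forall>c\<in>A. \<forall>x\<in>slit_coords c. \<forall>r j h k.
           CF_curvature_lowered (local_L A F c) r j h k x
             = complex_of_real (in_coords A c K x) *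
               (g_lower (local_L A F c) j r x * g_lower (local_L A F c) k h x
                + g_lower (local_L A F c) k r x * g_lower (local_L A F c) j h x)"
    and nonzero: "\<forall>x\<in>slit_tangent_bundle A. K x \<noteq> 0"
begin

interpretation complex_surface A by unfold_locales (rule atlas)

text \<open>Carries the global hypotheses into one chart. The Euler identity comes from the scaling
  law of \<open>F\<close>, whose square has the weight required by
  \<open>euler_fibre\<close>.\<close>

lemma finsler_scalar_curvature_chart:
  assumes c: "c \<in> A"
  shows "finsler_scalar_curvature (slit_coords c) (local_L A F c)
    (\<lambda>x. complex_of_real (in_coords A c K x))"
proof unfold_locales
  have smooth: "smooth_on (slit_coords c) (\<lambda>x. (in_coords A c F x)\<^sup>2)"
    using finsler c by (simp add: complex_finsler_def)
  have L: "local_L A F c = (\<lambda>x. complex_of_real ((in_coords A c F x)\<^sup>2))"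
    by (simp add: local_L_def fun_eq_iff)
  show "open (slit_coords c)" by (rule open_slit_coords[OF c])
  then show "smooth_on (slit_coords c) (local_L A F c)"
    unfolding L by (rule smooth_on_bounded_linear_compose[OF _ bounded_linear_of_real smooth])
  show "cnj (local_L A F c x) = local_L A F c x" for x by (simp add: local_L_def)
  show "cnj (complex_of_real (in_coords A c K x)) = complex_of_real (in_coords A c K x)" for x by simp
  fix x assume x: "x \<in> slit_coords c"
  then show "snd x \<noteq> 0" by (auto simp: slit_coords_def)
  show "hermitian_pos_def (g_matrix (local_L A F c) x)"
    using finsler c x by (simp add: complex_finsler_def)
  show "CF_curvature_lowered (local_L A F c) r j h k x
      = complex_of_real (in_coords A c K x) * (g_lower (local_L A F c) j r x * g_lower (local_L A F c) k h x
        + g_lower (local_L A F c) k r x * g_lower (local_L A F c) j h x)" for r j h k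
    using curvature c x by blast
  obtain z \<eta> where z: "x = (z, \<eta>)" by (cases x)
  show "complex_of_real (in_coords A c K x) \<noteq> 0"
    using nonzero slit_coords_mem[OF c, of z \<eta>] x by (simp add: z in_coords_def)
  let ?p = "chart_inv c z"
  have p: "?p \<in> fst c" using x z c by (auto simp: slit_coords_def)
  have "in_coords A c F (z, \<mu> *s \<eta>) = cmod \<mu> * in_coords A c F (z, \<eta>)" for \<mu>
    using finsler tvec_of_tangent[OF c p, of \<eta>] tvec_of_scale[OF c p, of \<mu> \<eta>]
    by (auto simp: complex_finsler_def in_coords_def)
  then show "(\<Sum>k\<in>UNIV. snd x $ k * d_eta k (local_L A F c) x) = local_L A F c x"
    using euler_fibre[of "\<lambda>x. (in_coords A c F x)\<^sup>2" z \<eta>] smooth_on_differentiable[OF smooth x]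
    by (simp add: L z power_mult_distrib)
qed

lemma kaehler_if_constant:
  assumes K: "\<forall>x\<in>slit_tangent_bundle A. K x = \<kappa>"
  shows "finsler_kaehler A F"
  unfolding finsler_kaehler_def
proof (intro ballI allI)
  fix c x i k assume c: "c \<in> A" and x: "x \<in> slit_coords c"
  interpret finsler_scalar_curvature "slit_coords c" "local_L A F c" "\<lambda>x. complex_of_real (in_coords A c K x)"
    by (rule finsler_scalar_curvature_chart[OF c])
  have "in_coords A c K y = \<kappa>" if "y \<in> slit_coords c" for y
    using K slit_coords_mem[OF c] that by (cases y) (simp add: in_coords_def)
  then have "d_z k (\<lambda>x. complex_of_real (in_coords A c K x)) x = d_z k (\<lambda>x. complex_of_real \<kappa>) x" for k
    by (intro d_cong(1)[OF x]) simp
  then show "(\<Sum>j\<in>UNIV. CF_torsion (local_L A F c) i j k x * snd x $ j) = 0"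
    by (simp add: torsion_zero_if_constant[OF x])
qed

text \<open>In a chart the \<open>z\<close> derivatives of \<open>K\<close> vanish by the Kaehler
  condition and the fibre derivatives by \<open>d_eta_\<kappa>\<close>, so \<open>K\<close> is
  constant on connected open sets of coordinates.\<close>

lemma locally_constant_if_kaehler:
  assumes kaehler: "finsler_kaehler A F"
  shows "\<exists>W \<kappa>. open W \<and> p \<in> W \<and> (\<forall>q v. q \<in> W \<longrightarrow> (q, v) \<in> slit_tangent_bundle A \<longrightarrow> K (q, v) = \<kappa>)"
proof -
  obtain c where c: "c \<in> A" "p \<in> fst c" by (rule chart_around)
  let ?\<kappa> = "\<lambda>x. complex_of_real (in_coords A c K x)"
  interpret finsler_scalar_curvature "slit_coords c" "local_L A F c" ?\<kappa>
    by (rule finsler_scalar_curvature_chart[OF c(1)])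
  obtain r where r: "r > 0" "ball (snd c p) r \<subseteq> snd c ` fst c"
    using chart(2)[OF c(1)] c(2) open_contains_ball by blast
  \<comment> \<open>The punctured fibre has real dimension four and stays connected, so a single
    constant serves all nonzero vectors over the ball.\<close>
  let ?B = "ball (snd c p) r \<times> (- {0 :: complex^2})"
  have sub: "?B \<subseteq> slit_coords c" using r by (auto simp: slit_coords_def)
  have "open ?B" by (intro open_Times) auto
  moreover have "connected ?B"
    by (intro connected_Times connected_punctured_universe) auto
  moreover have "(?\<kappa> has_derivative (\<lambda>v. 0)) (at x)" if "x \<in> ?B" for x
  proof -
    have x: "x \<in> slit_coords c" using sub that by blast
    have diff: "?\<kappa> differentiable at x"
      by (rule smooth_on_differentiable[OF smooth_\<kappa> x])
    have "frechet_derivative ?\<kappa> (at x) = (\<lambda>v. 0)"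
    proof (rule frechet_derivative_eq_0[OF diff real_\<kappa>])
      show "d_z k ?\<kappa> x = 0" for k
        using kaehler c(1) by (intro d_z_\<kappa>_zero_if_kaehler[OF _ x]) (simp add: finsler_kaehler_def)
    qed (rule d_eta_\<kappa>[OF x])
    then show ?thesis using diff frechet_derivative_works by metis
  qed
  ultimately have const: "?\<kappa> x = ?\<kappa> y" if "x \<in> ?B" "y \<in> ?B" for x y
    using that by (rule has_derivative_zero_unique_connected)
  define k where "k = in_coords A c K (snd c p, axis 1 1)"
  have k: "in_coords A c K x = k" if "x \<in> ?B" for x
    using const[OF that, of "(snd c p, axis 1 1)"] r(1) by (simp add: k_def)
  let ?W = "snd c -` ball (snd c p) r \<inter> fst c"
  have "open ?W"
    using continuous_open_preimage[OF chart(4,1)[OF c(1)], of "ball (snd c p) r"] by (simp add: Int_commute)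
  moreover have "p \<in> ?W" using r c by simp
  moreover have "K (q, v) = k" if "q \<in> ?W" "(q, v) \<in> slit_tangent_bundle A" for q v
  proof -
    have "(snd c q, v c) \<in> ?B"
      using that slit_tangentE(2)[OF that(2) c(1)] by auto
    from k[OF this] show ?thesis
      using that c(1) slit_tangentE(1)[OF that(2) c(1)] by (simp add: in_coords_def)
  qed
  ultimately show ?thesis by blast
qed

text \<open>On the connected base, the set of points over which \<open>K\<close> has a given value
  is open with open complement.\<close>

lemma constant_if_kaehler:
  assumes "connected (UNIV :: 'a set)" "finsler_kaehler A F"
  shows "\<exists>\<kappa>. \<forall>x\<in>slit_tangent_bundle A. K x = \<kappa>"
proof -
  define V where "V \<kappa> = {p. \<forall>v. (p, v) \<in> slit_tangent_bundle A \<longrightarrow> K (p, v) = \<kappa>}" for \<kappa>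
  note local = locally_constant_if_kaehler[OF assms(2)]
  \<comment> \<open>Nonempty slit fibres keep two different constants from holding over the same
    point.\<close>
  have fibre: "\<exists>v. (p, v) \<in> slit_tangent_bundle A" for p
  proof -
    obtain c where "c \<in> A" "p \<in> fst c" by (rule chart_around)
    then show ?thesis using tvec_of_slit[of c p "axis 1 1"] by auto
  qed
  \<comment> \<open>Any base point would do; \<open>undefined\<close> only fixes the candidate
    value.\<close>
  obtain \<kappa> where \<kappa>: "undefined \<in> V \<kappa>" using local[of undefined] unfolding V_def by blast
  have "open (V \<kappa>)"
  proof (subst open_subopen, intro ballI)
    fix p assume p: "p \<in> V \<kappa>"
    obtain W \<kappa>' where W: "open W" "p \<in> W" "\<And>q v. q \<in> W \<Longrightarrow> (q, v) \<in> slit_tangent_bundle A \<Longrightarrow> K (q, v) = \<kappa>'"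
      using local by blast
    then have "\<kappa>' = \<kappa>" using fibre[of p] p unfolding V_def by auto
    with W show "\<exists>T. open T \<and> p \<in> T \<and> T \<subseteq> V \<kappa>" unfolding V_def by blast
  qed
  moreover have "open (- V \<kappa>)"
  proof (subst open_subopen, intro ballI)
    fix p assume p: "p \<in> - V \<kappa>"
    obtain W \<kappa>' where W: "open W" "p \<in> W" "\<And>q v. q \<in> W \<Longrightarrow> (q, v) \<in> slit_tangent_bundle A \<Longrightarrow> K (q, v) = \<kappa>'"
      using local by blast
    then have "\<kappa>' \<noteq> \<kappa>" using p unfolding V_def by auto
    then have "W \<subseteq> - V \<kappa>" using W(3) fibre unfolding V_def by fastforce
    with W show "\<exists>T. open T \<and> p \<in> T \<and> T \<subseteq> - V \<kappa>" by blast
  qed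
  ultimately have "V \<kappa> = {} \<or> V \<kappa> = UNIV"
    using assms(1) by (simp add: connected_clopen closed_def)
  with \<kappa> have "V \<kappa> = UNIV" by auto
  then have "K (q, v) = \<kappa>" if "(q, v) \<in> slit_tangent_bundle A" for q v
    using that unfolding V_def by blast
  then show ?thesis by (intro exI[of _ \<kappa>]) (auto simp: split_paired_all)
qed

end

theorem theorem4p14:
  fixes A :: "('a::{t2_space, second_countable_topology}) chart set"
    and F K :: "'a \<times> 'a tvec \<Rightarrow> real"
  assumes "complex_atlas2 A"
    and "connected (UNIV :: 'a set)"
    and "complex_finsler A F"
    and "\<forall>c\<in>A. \<forall>x\<in>slit_coords c. \<forall>r j h k.
           CF_curvature_lowered (local_L A F c) r j h k x
             = complex_of_real (in_coords A c K x) *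
               (g_lower (local_L A F c) j r x * g_lower (local_L A F c) k h x
                + g_lower (local_L A F c) k r x * g_lower (local_L A F c) j h x)"
    and "\<forall>x\<in>slit_tangent_bundle A. K x \<noteq> 0"
  shows "(\<exists>\<kappa>. \<forall>x\<in>slit_tangent_bundle A. K x = \<kappa>) \<longleftrightarrow> finsler_kaehler A F"
  using kaehler_if_constant[OF assms(1,3-5)] constant_if_kaehler[OF assms(1,3-5,2)] by blast

end
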